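(* Let $P$ be a smooth manifold, let $L\subset TP\oplus T^*P$ be a regular almost Dirac structure and let $(F,\Omega_F)$ be the pair associated to it. Then $\Omega_F$ is nondegenerate if and only if $L$ is the graph of a bivector field $\pi$, i.e. $L=\{(\pi^\sharp(\alpha),\alpha):\alpha\in T^*P\}$. Explicitly, the relation between $(F,\Omega_F)$ and $\pi$ is $$\pi^\sharp(\alpha)=-X\quad\text{if and only if}\quad\mathbf{i}_X\Omega_F=\alpha|_F,$$ where $X\in\Gamma(F)$ and $\alpha\in\Omega^1(P)$.
   Context: An almost Dirac structure on $P$ is a subbundle $L\subset TP\oplus T^*P$ that is maximal isotropic for the pairing $\langle(X,\alpha),(Y,\beta)\rangle=\alpha(Y)+\beta(X)$; it is regular if $\mathrm{pr}_1(L)\subset TP$ has constant rank. The pair associated to a regular $L$ is $F=\mathrm{pr}_1(L)$ together with $\Omega_F\in\Gamma(\bigwedge^2F^* )$ defined by $\Omega_F(X,Y)=-\alpha(Y)$ for $X,Y\in F$, $(X,\alpha)\in L$ (independent of the choice of $\alpha$); thus $L=\{(X,\alpha):X\in F,\ \mathbf{i}_X\Omega_F=-\alpha|_F\}$. $\Omega_F$ is nondegenerate if it is nondegenerate as a bilinear form on $F$ at each point. For a bivector field $\pi$, $\pi^\sharp:T^*P\to TP$ is defined by $\beta(\pi^\sharp(\alpha))=\pi(\alpha,\beta)$. *)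

theory Defs
  imports "HOL-Analysis.Analysis" "HOL-Library.Function_Algebras"
begin

text \<open>The pointwise vector space structure on functions (addition is in
  \<^theory>\<open>HOL-Library.Function_Algebras\<close>); tangent vectors and covectors below are functions.\<close>

instantiation "fun" :: (type, real_vector) real_vector
begin

definition scaleR_fun :: "real \<Rightarrow> ('a \<Rightarrow> 'b) \<Rightarrow> 'a \<Rightarrow> 'b"
  where "scaleR_fun r f = (\<lambda>x. r *\<^sub>R f x)"

instance
  by standard (simp_all add: scaleR_fun_def fun_eq_iff plus_fun_def scaleR_add_right scaleR_add_left)

end


section \<open>Smooth maps and manifolds\<close>

text \<open>Only used for open \<open>S\<close> in finite-dimensional spaces, where it is the usual notion
  of a \<open>C\<^sup>k\<close> map.\<close>

primrec Ck_on :: "nat \<Rightarrow> 'a::real_normed_vector set \<Rightarrow> ('a \<Rightarrow> 'b::real_normed_vector) \<Rightarrow> bool"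
  where
    "Ck_on 0 S f \<longleftrightarrow> continuous_on S f"
  | "Ck_on (Suc k) S f \<longleftrightarrow>
       (\<forall>x\<in>S. f differentiable (at x)) \<and>
       (\<forall>v. Ck_on k S (\<lambda>x. frechet_derivative f (at x) v))"

definition smooth_on :: "'a::real_normed_vector set \<Rightarrow> ('a \<Rightarrow> 'b::real_normed_vector) \<Rightarrow> bool"
  where "smooth_on S f \<longleftrightarrow> (\<forall>k. Ck_on k S f)"

text \<open>A chart is a pair of its domain and its coordinate map; the values of the map outside
  the domain are irrelevant.\<close>

type_synonym ('p, 'e) chart = "'p set \<times> ('p \<Rightarrow> 'e)"

abbreviation chart_inv :: "('p, 'e) chart \<Rightarrow> 'e \<Rightarrow> 'p"
  where "chart_inv c \<equiv> inv_into (fst c) (snd c)"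

definition is_chart :: "('p::topological_space, 'e::topological_space) chart \<Rightarrow> bool"
  where "is_chart c \<longleftrightarrow> open (fst c) \<and> open (snd c ` fst c) \<and>
    homeomorphism (fst c) (snd c ` fst c) (snd c) (chart_inv c)"

definition transition :: "('p, 'e) chart \<Rightarrow> ('p, 'e) chart \<Rightarrow> 'e \<Rightarrow> 'e"
  where "transition c d = snd d \<circ> chart_inv c"

text \<open>The model space \<open>'e\<close> is any finite-dimensional inner product space. The class
  \<^class>\<open>euclidean_space\<close> is not used because it excludes dimension 0.
  The manifold is the union of the chart domains, an open subset of a second countable
  Hausdorff space; the atlas \<open>A\<close> need not be maximal.\<close>

definition smooth_manifold ::
    "('p::{t2_space, second_countable_topology}, 'e::real_inner) chart set \<Rightarrow> bool"
  where "smooth_manifold A \<longleftrightarrow>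
    (\<exists>B :: 'e set. finite B \<and> span B = UNIV) \<and>
    (\<forall>c\<in>A. is_chart c) \<and>
    (\<forall>c\<in>A. \<forall>d\<in>A. smooth_on (snd c ` (fst c \<inter> fst d)) (transition c d))"

definition points :: "('p, 'e) chart set \<Rightarrow> 'p set"
  where "points A = (\<Union>c\<in>A. fst c)"


section \<open>Tangent and cotangent spaces\<close>

text \<open>A tangent vector at \<open>p\<close> is given by its components in all charts around \<open>p\<close>, related
  by the derivatives of the transition maps (and extended by 0 to everything that is not a
  chart around \<open>p\<close>).\<close>

type_synonym ('p, 'e) tvec = "('p, 'e) chart \<Rightarrow> 'e"

definition tangent_space :: "('p, 'e::real_normed_vector) chart set \<Rightarrow> 'p \<Rightarrow> ('p, 'e) tvec set"
  where "tangent_space A p = {v.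
    (\<forall>c\<in>A. \<forall>d\<in>A. p \<in> fst c \<inter> fst d \<longrightarrow>
       v d = frechet_derivative (transition c d) (at (snd c p)) (v c)) \<and>
    (\<forall>c. \<not> (c \<in> A \<and> p \<in> fst c) \<longrightarrow> v c = 0)}"

text \<open>Linear functionals on a subspace \<open>V\<close>, extended by 0 outside \<open>V\<close> so that they are
  determined by their restriction to \<open>V\<close>.\<close>

definition dual_space :: "'v::real_vector set \<Rightarrow> ('v \<Rightarrow> real) set"
  where "dual_space V = {\<alpha>.
    (\<forall>v\<in>V. \<forall>w\<in>V. \<alpha> (v + w) = \<alpha> v + \<alpha> w) \<and>
    (\<forall>r. \<forall>v\<in>V. \<alpha> (r *\<^sub>R v) = r * \<alpha> v) \<and>
    (\<forall>v. v \<notin> V \<longrightarrow> \<alpha> v = 0)}"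

type_synonym ('p, 'e) covec = "('p, 'e) tvec \<Rightarrow> real"

definition cotangent_space :: "('p, 'e::real_normed_vector) chart set \<Rightarrow> 'p \<Rightarrow> ('p, 'e) covec set"
  where "cotangent_space A p = dual_space (tangent_space A p)"

text \<open>The tangent vector at \<open>p\<close> whose component in the chart \<open>c\<close> is \<open>v\<close>, and the covector
  at \<open>p\<close> which in the chart \<open>c\<close> is the linear functional \<open>\<xi>\<close>.\<close>

definition coord_vec ::
    "('p, 'e::real_normed_vector) chart set \<Rightarrow> ('p, 'e) chart \<Rightarrow> 'p \<Rightarrow> 'e \<Rightarrow> ('p, 'e) tvec"
  where "coord_vec A c p v = (\<lambda>d.
    if d \<in> A \<and> p \<in> fst d then frechet_derivative (transition c d) (at (snd c p)) v else 0)"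

definition coord_covec ::
    "('p, 'e::real_normed_vector) chart set \<Rightarrow> ('p, 'e) chart \<Rightarrow> 'p \<Rightarrow> ('e \<Rightarrow> real) \<Rightarrow> ('p, 'e) covec"
  where "coord_covec A c p \<xi> = (\<lambda>v. if v \<in> tangent_space A p then \<xi> (v c) else 0)"


section \<open>Smooth sections\<close>

text \<open>Sections over an open subset \<open>U\<close> of the manifold; smoothness means smoothness of the
  components in every chart. Their values outside \<open>U\<close> are irrelevant.\<close>

definition vector_field_on ::
    "('p, 'e::real_normed_vector) chart set \<Rightarrow> 'p set \<Rightarrow> ('p \<Rightarrow> ('p, 'e) tvec) \<Rightarrow> bool"
  where "vector_field_on A U X \<longleftrightarrow>
    (\<forall>p\<in>U. X p \<in> tangent_space A p) \<and>
    (\<forall>c\<in>A. smooth_on (snd c ` (U \<inter> fst c)) (\<lambda>x. X (chart_inv c x) c))"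

definition one_form_on ::
    "('p, 'e::real_normed_vector) chart set \<Rightarrow> 'p set \<Rightarrow> ('p \<Rightarrow> ('p, 'e) covec) \<Rightarrow> bool"
  where "one_form_on A U \<alpha> \<longleftrightarrow>
    (\<forall>p\<in>U. \<alpha> p \<in> cotangent_space A p) \<and>
    (\<forall>c\<in>A. \<forall>v. smooth_on (snd c ` (U \<inter> fst c))
       (\<lambda>x. \<alpha> (chart_inv c x) (coord_vec A c (chart_inv c x) v)))"

text \<open>A bivector at \<open>p\<close> is regarded as an alternating bilinear form on the cotangent space.\<close>

definition alternating_form_on :: "'v::real_vector set \<Rightarrow> ('v \<Rightarrow> 'v \<Rightarrow> real) \<Rightarrow> bool"
  where "alternating_form_on V b \<longleftrightarrow>
    (\<forall>u\<in>V. \<forall>v\<in>V. \<forall>w\<in>V. b (u + v) w = b u w + b v w) \<and>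
    (\<forall>r. \<forall>u\<in>V. \<forall>v\<in>V. b (r *\<^sub>R u) v = r * b u v) \<and>
    (\<forall>u\<in>V. \<forall>v\<in>V. \<forall>w\<in>V. b u (v + w) = b u v + b u w) \<and>
    (\<forall>r. \<forall>u\<in>V. \<forall>v\<in>V. b u (r *\<^sub>R v) = r * b u v) \<and>
    (\<forall>u\<in>V. b u u = 0)"

definition bivector_field ::
    "('p, 'e::real_normed_vector) chart set \<Rightarrow>
     ('p \<Rightarrow> ('p, 'e) covec \<Rightarrow> ('p, 'e) covec \<Rightarrow> real) \<Rightarrow> bool"
  where "bivector_field A \<pi> \<longleftrightarrow>
    (\<forall>p\<in>points A. alternating_form_on (cotangent_space A p) (\<pi> p)) \<and>
    (\<forall>c\<in>A. \<forall>\<xi> \<eta>. linear \<xi> \<and> linear \<eta> \<longrightarrow>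
       smooth_on (snd c ` fst c)
         (\<lambda>x. \<pi> (chart_inv c x) (coord_covec A c (chart_inv c x) \<xi>)
                                   (coord_covec A c (chart_inv c x) \<eta>)))"

text \<open>The map \<open>\<pi>\<^sup>\<sharp>\<close> at \<open>p\<close>, with the convention \<open>\<beta> (\<pi>\<^sup>\<sharp> \<alpha>) = \<pi> (\<alpha>, \<beta>)\<close>.\<close>

definition sharp ::
    "('p, 'e::real_normed_vector) chart set \<Rightarrow>
     ('p \<Rightarrow> ('p, 'e) covec \<Rightarrow> ('p, 'e) covec \<Rightarrow> real) \<Rightarrow> 'p \<Rightarrow> ('p, 'e) covec \<Rightarrow> ('p, 'e) tvec"
  where "sharp A \<pi> p \<alpha> =
    (THE X. X \<in> tangent_space A p \<and> (\<forall>\<beta>\<in>cotangent_space A p. \<beta> X = \<pi> p \<alpha> \<beta>))"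


section \<open>Almost Dirac structures\<close>

text \<open>A subset of \<open>TP \<oplus> T\<^sup>*P\<close> is given by the family of its fibres.\<close>

type_synonym ('p, 'e) fibres = "'p \<Rightarrow> (('p, 'e) tvec \<times> ('p, 'e) covec) set"

text \<open>The rank of a subbundle may vary between components of the manifold; for almost Dirac
  structures it is forced to be the dimension of the manifold.\<close>

definition smooth_subbundle ::
    "('p::topological_space, 'e::real_normed_vector) chart set \<Rightarrow> ('p, 'e) fibres \<Rightarrow> bool"
  where "smooth_subbundle A L \<longleftrightarrow>
    (\<forall>p\<in>points A. subspace (L p) \<and> L p \<subseteq> tangent_space A p \<times> cotangent_space A p) \<and>
    (\<forall>p\<in>points A. \<exists>U k. \<exists>X :: nat \<Rightarrow> 'p \<Rightarrow> ('p, 'e) tvec. \<exists>\<alpha> :: nat \<Rightarrow> 'p \<Rightarrow> ('p, 'e) covec.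
       open U \<and> p \<in> U \<and> U \<subseteq> points A \<and>
       (\<forall>i<k. vector_field_on A U (X i) \<and> one_form_on A U (\<alpha> i)) \<and>
       (\<forall>q\<in>U. inj_on (\<lambda>i. (X i q, \<alpha> i q)) {..<k} \<and>
          independent ((\<lambda>i. (X i q, \<alpha> i q)) ` {..<k}) \<and>
          span ((\<lambda>i. (X i q, \<alpha> i q)) ` {..<k}) = L q))"

fun pairing :: "'v \<times> ('v \<Rightarrow> real) \<Rightarrow> 'v \<times> ('v \<Rightarrow> real) \<Rightarrow> real"
  where "pairing (X, \<alpha>) (Y, \<beta>) = \<alpha> Y + \<beta> X"

definition isotropic :: "('v \<times> ('v \<Rightarrow> real)) set \<Rightarrow> bool"
  where "isotropic W \<longleftrightarrow> (\<forall>u\<in>W. \<forall>w\<in>W. pairing u w = 0)"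

definition maximal_isotropic ::
    "('v::real_vector \<times> ('v \<Rightarrow> real)) set \<Rightarrow> ('v \<times> ('v \<Rightarrow> real)) set \<Rightarrow> bool"
  where "maximal_isotropic E W \<longleftrightarrow>
    subspace W \<and> W \<subseteq> E \<and> isotropic W \<and>
    (\<forall>W'. subspace W' \<and> W' \<subseteq> E \<and> isotropic W' \<and> W \<subseteq> W' \<longrightarrow> W' = W)"

definition almost_Dirac ::
    "('p::topological_space, 'e::real_normed_vector) chart set \<Rightarrow> ('p, 'e) fibres \<Rightarrow> bool"
  where "almost_Dirac A L \<longleftrightarrow> smooth_subbundle A L \<and>
    (\<forall>p\<in>points A. maximal_isotropic (tangent_space A p \<times> cotangent_space A p) (L p))"

definition assoc_dist :: "('p, 'e) fibres \<Rightarrow> 'p \<Rightarrow> ('p, 'e) tvec set"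
  where "assoc_dist L p = fst ` L p"

definition regular ::
    "('p, 'e::real_normed_vector) chart set \<Rightarrow> ('p, 'e) fibres \<Rightarrow> bool"
  where "regular A L \<longleftrightarrow> (\<exists>r. \<forall>p\<in>points A. dim (assoc_dist L p) = r)"

text \<open>\<open>\<Omega>\<^sub>F (X, Y) = - \<alpha> (Y)\<close> for any \<open>\<alpha>\<close> with \<open>(X, \<alpha>) \<in> L\<close>; only meaningful
  for \<open>X\<close> and \<open>Y\<close> in \<open>F\<close>.\<close>

definition assoc_form :: "('p, 'e) fibres \<Rightarrow> 'p \<Rightarrow> ('p, 'e) tvec \<Rightarrow> ('p, 'e) tvec \<Rightarrow> real"
  where "assoc_form L p X Y = - (SOME \<alpha>. (X, \<alpha>) \<in> L p) Y"

lemma assoc_form_eq: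
  assumes "isotropic (L p)" "(X, \<alpha>) \<in> L p" "Y \<in> assoc_dist L p"
  shows "assoc_form L p X Y = - \<alpha> Y"
proof -
  from assms(3) obtain \<beta> where \<beta>: "(Y, \<beta>) \<in> L p"
    by (auto simp: assoc_dist_def)
  have *: "\<gamma> Y = - \<beta> X" if "(X, \<gamma>) \<in> L p" for \<gamma>
  proof -
    have "pairing (X, \<gamma>) (Y, \<beta>) = 0"
      using assms(1) that \<beta> unfolding isotropic_def by blast
    then show ?thesis
      by simp
  qed
  have "(X, SOME \<gamma>. (X, \<gamma>) \<in> L p) \<in> L p"
    using someI[of "\<lambda>\<gamma>. (X, \<gamma>) \<in> L p", OF assms(2)] .
  then show ?thesis
    using *[OF assms(2)] * by (simp add: assoc_form_def)
qed

definition nondegenerate_on :: "'v::zero set \<Rightarrow> ('v \<Rightarrow> 'v \<Rightarrow> real) \<Rightarrow> bool"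
  where "nondegenerate_on V b \<longleftrightarrow>
    (\<forall>u\<in>V. (\<forall>v\<in>V. b u v = 0) \<longrightarrow> u = 0) \<and>
    (\<forall>v\<in>V. (\<forall>u\<in>V. b u v = 0) \<longrightarrow> v = 0)"

definition is_graph_of ::
    "('p, 'e::real_normed_vector) chart set \<Rightarrow> ('p, 'e) fibres \<Rightarrow>
     ('p \<Rightarrow> ('p, 'e) covec \<Rightarrow> ('p, 'e) covec \<Rightarrow> real) \<Rightarrow> bool"
  where "is_graph_of A L \<pi> \<longleftrightarrow>
    (\<forall>p\<in>points A. L p = {(sharp A \<pi> p \<alpha>, \<alpha>) | \<alpha>. \<alpha> \<in> cotangent_space A p})"

end

theory Submission
  imports Defs
begin

text \<open>Maximality says that \<open>(X, \<alpha>)\<close> lies in \<open>L\<close> as soon as \<open>\<alpha> X = 0\<close> and \<open>(X, \<alpha>)\<close> is orthogonal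
  to \<open>L\<close>. Hence a vector annihilated by all covectors of \<open>L\<close> gives an element \<open>(X, 0)\<close> of \<open>L\<close>;
  if \<open>\<Omega>\<^sub>F\<close> is nondegenerate, no such \<open>X \<noteq> 0\<close> exists, so the projection of \<open>L\<close> to the cotangent
  space is bijective and its inverse is \<open>\<alpha> \<mapsto> (\<pi>\<^sup>\<sharp> \<alpha>, \<alpha>)\<close>. Isotropy makes \<open>\<pi>\<close> alternating. Smoothness
  follows from a local frame of \<open>L\<close>: its covector parts are a coframe, and expanding a constant
  covector in it amounts to solving a smooth invertible linear system.\<close>

section \<open>Smooth functions\<close>

text \<open>Derivatives at a point of an open set see only nearby values, so both functions have the
  same derivatives there. This allows functions to be replaced by formulas valid on an open set
  only.\<close>

lemma Ck_on_cong:
  assumes "open S" "Ck_on k S f" "\<And>x. x \<in> S \<Longrightarrow> f x = g x"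
  shows "Ck_on k S g"
  using assms(2,3)
proof (induction k arbitrary: f g)
  case 0
  then show ?case using continuous_on_cong by fastforce
next
  case (Suc k)
  have D: "(g has_derivative frechet_derivative f (at x)) (at x)" if "x \<in> S" for x
  proof (rule has_derivative_transform_within_open[OF _ assms(1) that])
    show "(f has_derivative frechet_derivative f (at x)) (at x)"
      using Suc.prems(1) that frechet_derivative_works by auto
  qed (use Suc.prems in auto)
  have "frechet_derivative f (at x) v = frechet_derivative g (at x) v" if "x \<in> S" for x v
    using frechet_derivative_at[OF D[OF that]] by simp
  then have "Ck_on k S (\<lambda>x. frechet_derivative g (at x) v)" for v
    using Suc.IH[of "\<lambda>x. frechet_derivative f (at x) v"] Suc.prems(1) by simp
  with D show ?case by (auto simp: differentiable_def)
qed

text \<open>Closure of \<open>Ck_on\<close> under sums, products and inverses goes by induction on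
  the order. This rule lets each induction step use an explicit derivative formula instead of
  \<open>frechet_derivative\<close>.\<close>

lemma Ck_on_Suc_derivI:
  assumes "open S" "\<And>x. x \<in> S \<Longrightarrow> (f has_derivative f' x) (at x)"
    and "\<And>v. Ck_on k S (\<lambda>x. f' x v)"
  shows "Ck_on (Suc k) S f"
proof -
  have "f' x v = frechet_derivative f (at x) v" if "x \<in> S" for x v
    using frechet_derivative_at[OF assms(2)[OF that]] by simp
  then have "Ck_on k S (\<lambda>x. frechet_derivative f (at x) v)" for v
    using Ck_on_cong[OF assms(1) assms(3)] by simp
  then show ?thesis
    using assms(2) by (auto simp: differentiable_def)
qed

lemma Ck_on_Suc_deriv:
  assumes "Ck_on (Suc k) S f" "x \<in> S"
  shows "(f has_derivative frechet_derivative f (at x)) (at x)"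
  using assms frechet_derivative_works by auto

lemma Ck_on_SucD: "Ck_on (Suc k) S f \<Longrightarrow> Ck_on k S f"
proof (induction k arbitrary: f)
  case 0
  then show ?case
    by (metis Ck_on.simps differentiable_at_withinI differentiable_imp_continuous_on differentiable_on_def)
next
  case (Suc k)
  then show ?case by auto
qed

lemma Ck_on_subset: "Ck_on k S f \<Longrightarrow> T \<subseteq> S \<Longrightarrow> Ck_on k T f"
  by (induction k arbitrary: f) (auto intro: continuous_on_subset)

lemma Ck_on_const: "Ck_on k S (\<lambda>x. c)"
proof (induction k arbitrary: c)
  case (Suc k)
  have "frechet_derivative (\<lambda>x::'a. c) (at x) = (\<lambda>_. 0)" for x
    by (metis frechet_derivative_at has_derivative_const)
  with Suc show ?case by simp
qed simp

lemma Ck_on_add: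
  assumes "open S"
  shows "Ck_on k S f \<Longrightarrow> Ck_on k S g \<Longrightarrow> Ck_on k S (\<lambda>x. f x + g x)"
proof (induction k arbitrary: f g)
  case (Suc k)
  show ?case
    by (rule Ck_on_Suc_derivI[OF assms has_derivative_add[OF Suc.prems[THEN Ck_on_Suc_deriv]]])
      (use Suc in auto)
qed (auto intro: continuous_intros)

lemma Ck_on_bounded_linear:
  assumes "open S" "bounded_linear h"
  shows "Ck_on k S f \<Longrightarrow> Ck_on k S (\<lambda>x. h (f x))"
proof (induction k arbitrary: f)
  case 0
  then show ?case
    using bounded_linear.continuous_on[OF assms(2)] by auto
next
  case (Suc k)
  show ?case
    by (rule Ck_on_Suc_derivI[OF assms(1) bounded_linear.has_derivative[OF assms(2) Suc.prems[THEN Ck_on_Suc_deriv]]])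
      (use Suc in auto)
qed

lemma Ck_on_mult:
  fixes f g :: "'a::real_normed_vector \<Rightarrow> real"
  assumes "open S"
  shows "Ck_on k S f \<Longrightarrow> Ck_on k S g \<Longrightarrow> Ck_on k S (\<lambda>x. f x * g x)"
proof (induction k arbitrary: f g)
  case (Suc k)
  show ?case
    by (rule Ck_on_Suc_derivI[OF assms has_derivative_mult[OF Suc.prems[THEN Ck_on_Suc_deriv]]])
      (use Suc Ck_on_SucD[OF Suc.prems(1)] Ck_on_SucD[OF Suc.prems(2)] in \<open>auto intro!: Ck_on_add[OF assms]\<close>)
qed (auto intro: continuous_intros)

lemma Ck_on_inverse:
  fixes f :: "'a::real_normed_vector \<Rightarrow> real"
  assumes "open S" "\<And>x. x \<in> S \<Longrightarrow> f x \<noteq> 0"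
  shows "Ck_on k S f \<Longrightarrow> Ck_on k S (\<lambda>x. inverse (f x))"
proof (induction k)
  case 0
  then show ?case using assms by (auto intro: continuous_intros)
next
  case (Suc k)
  \<comment> \<open>The derivative of the reciprocal contains the reciprocal itself, but only to
    order \<open>k\<close>, which the induction hypothesis supplies.\<close>
  note IH = Suc.IH[OF Ck_on_SucD[OF Suc.prems]]
  show ?case
  proof (rule Ck_on_Suc_derivI[OF assms(1)])
    show "((\<lambda>x. inverse (f x)) has_derivative
        (\<lambda>h. - (inverse (f x) * frechet_derivative f (at x) h * inverse (f x)))) (at x)"
      if "x \<in> S" for x
      using that assms Suc.prems by (intro Deriv.has_derivative_inverse Ck_on_Suc_deriv) auto
    show "Ck_on k S (\<lambda>x. - (inverse (f x) * frechet_derivative f (at x) v * inverse (f x)))" for v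
      using Suc.prems IH by (intro Ck_on_bounded_linear[OF assms(1) bounded_linear_minus[OF bounded_linear_ident]]
          Ck_on_mult assms) auto
  qed
qed

text \<open>Continuity at a point and the derivative \<open>at x\<close> are local notions, so each
  order can be checked on neighbourhoods that vary with the point.\<close>

lemma Ck_on_local:
  assumes "\<And>x. x \<in> S \<Longrightarrow> \<exists>U. open U \<and> x \<in> U \<and> Ck_on k U f"
  shows "Ck_on k S f"
  using assms
proof (induction k arbitrary: f)
  case 0
  have "isCont f x" if "x \<in> S" for x
    using 0[OF that] continuous_on_eq_continuous_at by auto
  then show ?case by (simp add: continuous_at_imp_continuous_on)
next
  case (Suc k)
  have "f differentiable at x" if "x \<in> S" for x
    using Suc.prems[OF that] by auto
  moreover have "Ck_on k S (\<lambda>x. frechet_derivative f (at x) v)" for v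
  proof (rule Suc.IH)
    show "\<exists>U. open U \<and> x \<in> U \<and> Ck_on k U (\<lambda>x. frechet_derivative f (at x) v)" if "x \<in> S" for x
      using Suc.prems[OF that] by auto
  qed
  ultimately show ?case by simp
qed

text \<open>A notion for germs: the domain is hidden, so it can shrink silently when functions are
  combined or divided. One neighbourhood serves all orders of differentiability at once.\<close>

definition smooth_at :: "'a::real_normed_vector \<Rightarrow> ('a \<Rightarrow> 'b::real_normed_vector) \<Rightarrow> bool"
  where "smooth_at x f \<longleftrightarrow> (\<exists>S. open S \<and> x \<in> S \<and> smooth_on S f)"

lemma smooth_on_imp_smooth_at: "smooth_on S f \<Longrightarrow> open S \<Longrightarrow> x \<in> S \<Longrightarrow> smooth_at x f"
  unfolding smooth_at_def by blast

lemma smooth_onD: "smooth_on S f \<Longrightarrow> Ck_on k S f"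
  by (simp add: smooth_on_def)

lemma smooth_atE:
  assumes "smooth_at x f"
  obtains S where "open S" "x \<in> S" "smooth_on S f"
  using assms unfolding smooth_at_def by blast

lemma smooth_atI: "open S \<Longrightarrow> x \<in> S \<Longrightarrow> (\<And>k. Ck_on k S f) \<Longrightarrow> smooth_at x f"
  unfolding smooth_at_def smooth_on_def by blast

lemma smooth_on_if_smooth_at:
  assumes "\<And>x. x \<in> S \<Longrightarrow> smooth_at x f"
  shows "smooth_on S f"
  unfolding smooth_on_def
proof (intro allI Ck_on_local)
  show "\<exists>U. open U \<and> x \<in> U \<and> Ck_on k U f" if "x \<in> S" for x k
    using smooth_atE[OF assms[OF that]] smooth_onD by metis
qed

lemma smooth_at_cong:
  assumes "smooth_at x f" "eventually (\<lambda>y. f y = g y) (nhds x)"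
  shows "smooth_at x g"
proof -
  obtain S where S: "open S" "x \<in> S" "smooth_on S f"
    by (rule smooth_atE[OF assms(1)])
  obtain T where T: "open T" "x \<in> T" "\<forall>y\<in>T. f y = g y"
    using assms(2) unfolding eventually_nhds by blast
  have "Ck_on k (S \<inter> T) g" for k
    by (rule Ck_on_cong[OF open_Int[OF S(1) T(1)] Ck_on_subset[OF smooth_onD[OF S(3)]]]) (use T(3) in auto)
  then show ?thesis
    using smooth_atI[of "S \<inter> T" x g] S(1,2) T(1,2) by blast
qed

lemma smooth_at_continuous:
  assumes "smooth_at x f"
  shows "isCont f x"
proof -
  obtain S where S: "open S" "x \<in> S" "smooth_on S f"
    by (rule smooth_atE[OF assms])
  then show ?thesis
    using smooth_onD[OF S(3), of 0] by (simp add: continuous_on_eq_continuous_at)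
qed

lemma smooth_at_const: "smooth_at x (\<lambda>_. c)"
  unfolding smooth_at_def smooth_on_def by (intro exI[of _ UNIV]) (simp add: Ck_on_const)

text \<open>The operation is applied on the intersection of the two neighbourhoods. Unary operations
  are covered by passing the same function twice.\<close>

lemma smooth_at_binop:
  assumes op: "\<And>k S. open S \<Longrightarrow> Ck_on k S f \<Longrightarrow> Ck_on k S g \<Longrightarrow> Ck_on k S h"
    and "smooth_at x f" "smooth_at x g"
  shows "smooth_at x h"
proof -
  obtain S where S: "open S" "x \<in> S" "smooth_on S f"
    by (rule smooth_atE[OF assms(2)])
  obtain T where T: "open T" "x \<in> T" "smooth_on T g"
    by (rule smooth_atE[OF assms(3)])
  have "Ck_on k (S \<inter> T) h" for k
    by (rule op[OF open_Int[OF S(1) T(1)] Ck_on_subset[OF smooth_onD[OF S(3)]] Ck_on_subset[OF smooth_onD[OF T(3)]]]) auto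
  then show ?thesis
    using smooth_atI[of "S \<inter> T" x h] S(1,2) T(1,2) by blast
qed

lemma smooth_at_add: "smooth_at x f \<Longrightarrow> smooth_at x g \<Longrightarrow> smooth_at x (\<lambda>y. f y + g y)"
  by (rule smooth_at_binop[OF Ck_on_add])

lemma smooth_at_mult:
  fixes f g :: "'a::real_normed_vector \<Rightarrow> real"
  shows "smooth_at x f \<Longrightarrow> smooth_at x g \<Longrightarrow> smooth_at x (\<lambda>y. f y * g y)"
  by (rule smooth_at_binop[OF Ck_on_mult])

lemma smooth_at_bounded_linear:
  assumes "bounded_linear h" "smooth_at x f"
  shows "smooth_at x (\<lambda>y. h (f y))"
  by (rule smooth_at_binop[OF Ck_on_bounded_linear[OF _ assms(1)] assms(2) assms(2)])

lemma smooth_at_diff: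
  assumes "smooth_at x f" "smooth_at x g"
  shows "smooth_at x (\<lambda>y. f y - g y)"
  using smooth_at_add[OF assms(1) smooth_at_bounded_linear[OF bounded_linear_minus[OF bounded_linear_ident] assms(2)]]
  by simp

lemma eventually_nonzero_nhds:
  fixes f :: "'a::real_normed_vector \<Rightarrow> real"
  assumes "smooth_at x f" "f x \<noteq> 0"
  shows "\<forall>\<^sub>F y in nhds x. f y \<noteq> 0"
  using tendsto_imp_eventually_ne[OF isContD[OF smooth_at_continuous[OF assms(1)]] assms(2)] assms(2)
  by (simp add: eventually_nhds_conv_at)

lemma smooth_at_divide:
  fixes f g :: "'a::real_normed_vector \<Rightarrow> real"
  assumes "smooth_at x f" "smooth_at x g" "g x \<noteq> 0"
  shows "smooth_at x (\<lambda>y. f y / g y)"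
proof -
  obtain S where S: "open S" "x \<in> S" "smooth_on S g"
    by (rule smooth_atE[OF assms(2)])
  obtain T where T: "open T" "x \<in> T" "\<forall>y\<in>T. g y \<noteq> 0"
    using eventually_nonzero_nhds[OF assms(2,3)] unfolding eventually_nhds by blast
  have "Ck_on k (S \<inter> T) (\<lambda>y. inverse (g y))" for k
    by (rule Ck_on_inverse[OF open_Int[OF S(1) T(1)] _ Ck_on_subset[OF smooth_onD[OF S(3)]]]) (use T(3) in auto)
  then have "smooth_at x (\<lambda>y. inverse (g y))"
    using smooth_atI[of "S \<inter> T" x] S(1,2) T(1,2) by blast
  from smooth_at_mult[OF assms(1) this] show ?thesis
    by (simp add: divide_inverse)
qed

lemma smooth_at_sum:
  "(\<And>i. i \<in> I \<Longrightarrow> smooth_at x (f i)) \<Longrightarrow> smooth_at x (\<lambda>y. \<Sum>i\<in>I. f i y)"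
  by (induction I rule: infinite_finite_induct) (auto intro: smooth_at_const smooth_at_add)

text \<open>Gaussian elimination, removing one unknown in each step; no inverse matrix is needed.\<close>

lemma smooth_at_linear_system:
  fixes a :: "nat \<Rightarrow> 'x::real_normed_vector \<Rightarrow> real" and M :: "nat \<Rightarrow> 'j \<Rightarrow> 'x \<Rightarrow> real"
  assumes "\<And>i j. i < k \<Longrightarrow> smooth_at x0 (M i j)" "\<And>j. smooth_at x0 (b j)"
    and "\<And>c i. (\<And>j. (\<Sum>i<k. c i * M i j x0) = 0) \<Longrightarrow> i < k \<Longrightarrow> c i = 0"
    and "\<And>j. \<forall>\<^sub>F x in nhds x0. (\<Sum>i<k. a i x * M i j x) = b j x"
    and "i < k"
  shows "smooth_at x0 (a i)"
  using assms
proof (induction k arbitrary: M b i)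
  case 0
  show ?case using \<open>i < 0\<close> by simp
next
  case (Suc k)
  note M = Suc.prems(1) and b = Suc.prems(2) and inj = Suc.prems(3) and eq = Suc.prems(4)
  \<comment> \<open>Existence of a pivot: otherwise the unit vector with entry 1 at \<open>k\<close>
    would be a nontrivial relation at \<open>x0\<close>.\<close>
  have "\<exists>j. M k j x0 \<noteq> 0"
    using inj[of "\<lambda>i. if i = k then 1 else 0" k] by (auto simp: if_distrib if_distribR cong: if_cong)
  then obtain j0 where j0: "M k j0 x0 \<noteq> 0" by blast
  have nz: "\<forall>\<^sub>F x in nhds x0. M k j0 x \<noteq> 0"
    by (rule eventually_nonzero_nhds[OF M j0]) simp
  \<comment> \<open>Equation \<open>j0\<close> is used to eliminate unknown \<open>k\<close> from
    every equation \<open>j\<close>. The quotient matters only near \<open>x0\<close>, where the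
    pivot is nonzero.\<close>
  define M' where "M' i j x = M i j x - M i j0 x * M k j x / M k j0 x" for i j x
  define b' where "b' j x = b j x - b j0 x * M k j x / M k j0 x" for j x
  have sum_M': "(\<Sum>i<k. c i * M' i j x)
      = (\<Sum>i<k. c i * M i j x) - (\<Sum>i<k. c i * M i j0 x) * M k j x / M k j0 x" for c j x
    by (simp add: M'_def sum_subtractf sum_distrib_left sum_divide_distrib algebra_simps)
  have *: "smooth_at x0 (a i)" if "i < k" for i
  proof (rule Suc.IH[of M' b'])
    show "smooth_at x0 (M' i j)" if "i < k" for i j
      unfolding M'_def using that j0
      by (intro smooth_at_diff smooth_at_divide smooth_at_mult M) auto
    show "smooth_at x0 (b' j)" for j
      unfolding b'_def using j0
      by (intro smooth_at_diff smooth_at_divide smooth_at_mult M b) auto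
    show "c i = 0" if c: "\<And>j. (\<Sum>i<k. c i * M' i j x0) = 0" and "i < k" for c i
    proof -
      \<comment> \<open>The last coefficient is chosen to make equation \<open>j0\<close> vanish. A
        relation of the reduced system thus extends to one of the full system, so injectivity is
        inherited.\<close>
      define c' where "c' = c(k := - (\<Sum>i<k. c i * M i j0 x0) / M k j0 x0)"
      have "(\<Sum>i<Suc k. c' i * M i j x0) = (\<Sum>i<k. c i * M' i j x0)" for j
        by (simp add: c'_def sum_M')
      then have "c' i = 0"
        using inj[of c' i] c \<open>i < k\<close> by simp
      then show ?thesis using \<open>i < k\<close> by (simp add: c'_def)
    qed
    show "\<forall>\<^sub>F x in nhds x0. (\<Sum>i<k. a i x * M' i j x) = b' j x" for j
      using eq[of j] eq[of j0] nz
    proof eventually_elim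
      case (elim x)
      have *: "(\<Sum>i<k. a i x * M i j x) = b j x - a k x * M k j x"
        "(\<Sum>i<k. a i x * M i j0 x) = b j0 x - a k x * M k j0 x"
        using elim(1,2) by auto
      show ?case
        unfolding sum_M' b'_def * using elim(3) by (simp add: field_simps)
    qed
    show "i < k" by fact
  qed
  \<comment> \<open>Back substitution: equation \<open>j0\<close> solved for the eliminated
    unknown.\<close>
  have "smooth_at x0 (\<lambda>x. (b j0 x - (\<Sum>i<k. a i x * M i j0 x)) / M k j0 x)"
    using j0 by (intro smooth_at_divide smooth_at_diff smooth_at_sum smooth_at_mult M b *) auto
  then have "smooth_at x0 (a k)"
  proof (rule smooth_at_cong)
    show "\<forall>\<^sub>F x in nhds x0. (b j0 x - (\<Sum>i<k. a i x * M i j0 x)) / M k j0 x = a k x"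
      using eq[of j0] nz
    proof eventually_elim
      case (elim x)
      then have "b j0 x - (\<Sum>i<k. a i x * M i j0 x) = a k x * M k j0 x"
        by simp
      with elim(2) show ?case by simp
    qed
  qed
  then show ?case using * \<open>i < Suc k\<close> less_SucE by blast
qed

section \<open>Linear algebra\<close>

text \<open>Riesz representation by a Gram-Schmidt step: each new generator contributes its
  component orthogonal to the earlier span. It later yields boundedness of linear functionals on the
  model space.\<close>

lemma linear_functional_eq_inner:
  fixes \<eta> :: "'e::real_inner \<Rightarrow> real"
  assumes "finite B" "linear \<eta>"
  shows "\<exists>a\<in>span B. \<forall>x\<in>span B. \<eta> x = a \<bullet> x"
  using assms
proof (induction B arbitrary: \<eta> rule: finite_induct)
  case empty
  then show ?case by (auto simp: linear_0)
next
  case (insert b B)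
  \<comment> \<open>The induction hypothesis for the functional \<open>inner b\<close> produces the
    orthogonal projection of \<open>b\<close> onto the span of \<open>B\<close>.\<close>
  obtain p where p: "p \<in> span B" "\<forall>x\<in>span B. b \<bullet> x = p \<bullet> x"
    using insert.IH[of "inner b"] bounded_linear.linear[OF bounded_linear_inner_right] by blast
  obtain a where a: "a \<in> span B" "\<forall>x\<in>span B. \<eta> x = a \<bullet> x"
    using insert.IH[OF insert.prems] by blast
  define u where "u = b - p"
  define t where "t = \<eta> u / (u \<bullet> u)"
  have sub: "span B \<subseteq> span (insert b B)"
    by (rule span_mono) auto
  have u: "u \<in> span (insert b B)"
    unfolding u_def using p sub by (intro span_diff) (auto intro: span_base)
  have ux: "u \<bullet> x = 0" if "x \<in> span B" for x
    using p that by (simp add: u_def inner_diff_left)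
  \<comment> \<open>If \<open>b\<close> already lies in the span of \<open>B\<close>, then
    \<open>u = 0\<close>, the division gives \<open>t = 0\<close>, and the equation still holds
    because \<open>\<eta> 0 = 0\<close>.\<close>
  have tu: "t * (u \<bullet> u) = \<eta> u"
    using linear_0[OF insert.prems] by (cases "u = 0") (auto simp: t_def)
  have "\<eta> x = (a + t *\<^sub>R u) \<bullet> x" if x_span: "x \<in> span (insert b B)" for x
  proof -
    obtain k where k: "x - k *\<^sub>R b \<in> span B"
      using x_span span_breakdown_eq[of x b B] by blast
    define y where "y = (x - k *\<^sub>R b) + k *\<^sub>R p"
    have y: "y \<in> span B"
      unfolding y_def using k p by (intro span_add span_scale)
    have x: "x = y + k *\<^sub>R u"
      by (simp add: y_def u_def algebra_simps)
    have "\<eta> x = \<eta> y + k * \<eta> u"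
      using insert.prems by (simp add: x linear_add linear_scale)
    also have "\<dots> = (a + t *\<^sub>R u) \<bullet> x"
      using a(2) y ux[OF y] ux[OF a(1)] tu
      by (simp add: x inner_add_left inner_add_right inner_commute[of a u])
    finally show ?thesis .
  qed
  moreover have "a + t *\<^sub>R u \<in> span (insert b B)"
    using a(1) sub u by (intro span_add span_scale) auto
  ultimately show ?case by blast
qed

section \<open>Vector spaces of functions and dual spaces\<close>

lemma scaleR_fun_apply: "(r *\<^sub>R f) x = r *\<^sub>R f x"
  by (simp add: scaleR_fun_def)

lemma sum_scaleR_fun_apply: "(\<Sum>i\<in>I. c i *\<^sub>R f i) x = (\<Sum>i\<in>I. c i *\<^sub>R f i x)"
  for f :: "'i \<Rightarrow> 'a \<Rightarrow> 'b::real_vector"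
  by (induction I rule: infinite_finite_induct) (simp_all add: scaleR_fun_apply)

lemma sum_scaleR_pair:
  "(\<Sum>i\<in>I. c i *\<^sub>R (f i, g i)) = (\<Sum>i\<in>I. c i *\<^sub>R f i, \<Sum>i\<in>I. c i *\<^sub>R g i)"
  by (induction I rule: infinite_finite_induct) (simp_all add: zero_prod_def)

lemma subspace_dual_space: "subspace (dual_space V)"
  unfolding subspace_def dual_space_def by (auto simp: scaleR_fun_apply algebra_simps)

lemma dual_spaceI:
  assumes "\<And>v w. v \<in> V \<Longrightarrow> w \<in> V \<Longrightarrow> \<alpha> (v + w) = \<alpha> v + \<alpha> w"
    and "\<And>r v. v \<in> V \<Longrightarrow> \<alpha> (r *\<^sub>R v) = r * \<alpha> v"
    and "\<And>v. v \<notin> V \<Longrightarrow> \<alpha> v = 0"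
  shows "\<alpha> \<in> dual_space V"
  unfolding dual_space_def using assms by blast

lemma dual_space_add: "\<alpha> \<in> dual_space V \<Longrightarrow> v \<in> V \<Longrightarrow> w \<in> V \<Longrightarrow> \<alpha> (v + w) = \<alpha> v + \<alpha> w"
  and dual_space_scale: "\<alpha> \<in> dual_space V \<Longrightarrow> v \<in> V \<Longrightarrow> \<alpha> (r *\<^sub>R v) = r * \<alpha> v"
  and dual_space_outside: "\<alpha> \<in> dual_space V \<Longrightarrow> v \<notin> V \<Longrightarrow> \<alpha> v = 0"
  unfolding dual_space_def by auto

lemma dual_space_eqI:
  assumes "\<alpha> \<in> dual_space V" "\<beta> \<in> dual_space V" "\<And>v. v \<in> V \<Longrightarrow> \<alpha> v = \<beta> v"
  shows "\<alpha> = \<beta>"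
  using assms dual_space_outside by (metis ext)

lemma dual_space_minus: "\<alpha> \<in> dual_space V \<Longrightarrow> v \<in> V \<Longrightarrow> \<alpha> (- v) = - \<alpha> v"
  using dual_space_scale[of \<alpha> V v "-1"] by simp

lemma dual_space_diff:
  assumes "\<alpha> \<in> dual_space V" "subspace V" "v \<in> V" "w \<in> V"
  shows "\<alpha> (v - w) = \<alpha> v - \<alpha> w"
  using dual_space_add[OF assms(1,3) subspace_neg[OF assms(2,4)]] dual_space_minus[OF assms(1,4)]
  by simp

text \<open>Induction on the number of functionals. If \<open>f k\<close> is nonzero somewhere on
  the common kernel of the earlier ones, subtracting a multiple of it from \<alpha> makes the
  difference vanish on that kernel; otherwise \<open>f k\<close> gets coefficient 0.\<close>

lemma functional_combination:
  fixes f :: "nat \<Rightarrow> 'v::real_vector \<Rightarrow> real"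
  assumes V: "subspace V" and f: "\<And>i. i < k \<Longrightarrow> f i \<in> dual_space V"
    and "\<alpha> \<in> dual_space V" "\<And>x. x \<in> V \<Longrightarrow> (\<And>i. i < k \<Longrightarrow> f i x = 0) \<Longrightarrow> \<alpha> x = 0"
  shows "\<exists>c. \<forall>x\<in>V. \<alpha> x = (\<Sum>i<k. c i * f i x)"
  using f assms(3,4)
proof (induction k arbitrary: \<alpha>)
  case 0
  then show ?case by simp
next
  case (Suc k)
  have fk: "f k \<in> dual_space V" and fi: "\<And>i. i < k \<Longrightarrow> f i \<in> dual_space V"
    using Suc.prems(1) by auto
  show ?case
  proof (cases "\<exists>y\<in>V. (\<forall>i<k. f i y = 0) \<and> f k y \<noteq> 0")
    case True
    then obtain y where y: "y \<in> V" "\<And>i. i < k \<Longrightarrow> f i y = 0" "f k y \<noteq> 0"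
      by auto
    define s where "s = \<alpha> y / f k y"
    define \<alpha>' where "\<alpha>' = \<alpha> - s *\<^sub>R f k"
    have \<alpha>'_eq: "\<alpha>' x = \<alpha> x - s * f k x" for x
      by (simp add: \<alpha>'_def scaleR_fun_apply)
    have "\<alpha>' \<in> dual_space V"
      unfolding \<alpha>'_def using subspace_dual_space Suc.prems(2) fk
      by (intro subspace_diff subspace_scale)
    moreover have "\<alpha>' x = 0" if x: "x \<in> V" "\<And>i. i < k \<Longrightarrow> f i x = 0" for x
    proof -
      define t where "t = f k x / f k y"
      \<comment> \<open>Moving along \<open>y\<close> keeps the earlier functionals zero and also
        kills \<open>f k\<close>, so the vanishing assumption on \<alpha> applies to
        \<open>z\<close>.\<close>
      define z where "z = x - t *\<^sub>R y"
      have ty: "t *\<^sub>R y \<in> V"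
        using subspace_scale[OF V y(1)] .
      have z: "z \<in> V"
        unfolding z_def using subspace_diff[OF V x(1) ty] .
      have fz: "g z = g x - t * g y" if "g \<in> dual_space V" for g
        unfolding z_def using dual_space_diff[OF that V x(1) ty] dual_space_scale[OF that y(1)]
        by simp
      have "f i z = 0" if "i < Suc k" for i
      proof (cases "i < k")
        case True
        then show ?thesis using fz[OF fi] x(2) y(2) by simp
      next
        case False
        with that have "i = k" by simp
        then show ?thesis using fz[OF fk] y(3) by (simp add: t_def)
      qed
      then have "\<alpha> z = 0" using Suc.prems(3)[OF z] by blast
      then show ?thesis
        using fz[OF Suc.prems(2)] by (simp add: \<alpha>'_eq s_def t_def field_simps)
    qed
    ultimately obtain c where c: "\<forall>x\<in>V. \<alpha>' x = (\<Sum>i<k. c i * f i x)"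
      using Suc.IH[of \<alpha>'] fi by blast
    have "\<forall>x\<in>V. \<alpha> x = (\<Sum>i<Suc k. (c(k := s)) i * f i x)"
      using c by (auto simp: \<alpha>'_eq algebra_simps)
    then show ?thesis by blast
  next
    case False
    have "\<alpha> x = 0" if "x \<in> V" "\<And>i. i < k \<Longrightarrow> f i x = 0" for x
      using Suc.prems(3)[OF that(1)] False that by (metis less_Suc_eq)
    then obtain c where c: "\<forall>x\<in>V. \<alpha> x = (\<Sum>i<k. c i * f i x)"
      using Suc.IH[of \<alpha>] fi Suc.prems(2) by blast
    have "\<forall>x\<in>V. \<alpha> x = (\<Sum>i<Suc k. (c(k := 0)) i * f i x)"
      using c by auto
    then show ?thesis by blast
  qed
qed

text \<open>Passes from independence of a set to that of an indexed family: injectivity allows the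
  coefficients to be transported to the vectors.\<close>

lemma independent_family_coeff_zero:
  assumes "inj_on g I" "independent (g ` I)" "finite I" "(\<Sum>i\<in>I. c i *\<^sub>R g i) = 0" "i \<in> I"
  shows "c i = 0"
proof -
  define u where "u v = c (inv_into I g v)" for v
  have u: "u (g i) = c i" if "i \<in> I" for i
    using assms(1) that by (simp add: u_def)
  have "(\<Sum>v\<in>g ` I. u v *\<^sub>R v) = (\<Sum>i\<in>I. c i *\<^sub>R g i)"
    using assms(1) u by (simp add: sum.reindex)
  then have "u (g i) = 0"
    using independentD[OF assms(2) _ subset_refl, of u "g i"] assms by simp
  then show ?thesis using u[OF assms(5)] by simp
qed

section \<open>Maximal isotropic subspaces\<close>

lemma isotropic_pairing: "isotropic W \<Longrightarrow> (X, \<alpha>) \<in> W \<Longrightarrow> (Y, \<beta>) \<in> W \<Longrightarrow> \<alpha> Y + \<beta> X = 0"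
  unfolding isotropic_def by (metis pairing.simps)

text \<open>Adjoining \<open>(X, \<alpha>)\<close> to \<open>W\<close> keeps the span isotropic, so
  maximality leaves no room for a larger subspace.\<close>

lemma maximal_isotropic_memI:
  assumes V: "subspace V" and W: "maximal_isotropic (V \<times> dual_space V) W"
    and X: "X \<in> V" and \<alpha>: "\<alpha> \<in> dual_space V" and \<alpha>X: "\<alpha> X = 0"
    and perp: "\<And>Y \<beta>. (Y, \<beta>) \<in> W \<Longrightarrow> \<alpha> Y + \<beta> X = 0"
  shows "(X, \<alpha>) \<in> W"
proof -
  have sW: "subspace W" and WE: "W \<subseteq> V \<times> dual_space V" and iW: "isotropic W"
    and max: "\<And>W'. subspace W' \<Longrightarrow> W' \<subseteq> V \<times> dual_space V \<Longrightarrow> isotropic W' \<Longrightarrow> W \<subseteq> W' \<Longrightarrow> W' = W"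
    using W unfolding maximal_isotropic_def by auto
  define W' where "W' = span (insert (X, \<alpha>) W)"
  have "isotropic W'"
    unfolding isotropic_def
  proof (intro ballI)
    fix u w assume "u \<in> W'" "w \<in> W'"
    then obtain r s where "u - r *\<^sub>R (X, \<alpha>) \<in> W" "w - s *\<^sub>R (X, \<alpha>) \<in> W"
      using span_eq_iff[THEN iffD2, OF sW] by (auto simp: W'_def span_insert)
    moreover obtain Y \<beta> Z \<gamma> where "u - r *\<^sub>R (X, \<alpha>) = (Y, \<beta>)" "w - s *\<^sub>R (X, \<alpha>) = (Z, \<gamma>)"
      by fastforce
    ultimately have YZ: "(Y, \<beta>) \<in> W" "(Z, \<gamma>) \<in> W"
      and u: "u = (Y + r *\<^sub>R X, \<beta> + r *\<^sub>R \<alpha>)" and w: "w = (Z + s *\<^sub>R X, \<gamma> + s *\<^sub>R \<alpha>)"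
      by (simp, simp, simp add: diff_eq_eq, simp add: diff_eq_eq)
    have V': "Y \<in> V" "Z \<in> V" "\<beta> \<in> dual_space V" "\<gamma> \<in> dual_space V"
      using YZ WE by auto
    have lin: "g (y + t *\<^sub>R X) = g y + t * g X" if "g \<in> dual_space V" "y \<in> V" for g y t
      using dual_space_add[OF that subspace_scale[OF V X]] dual_space_scale[OF that(1) X] by simp
    \<comment> \<open>The missing term in \<open>r * s\<close> is twice \<open>\<alpha> X\<close>,
      which is zero.\<close>
    have "pairing u w = (\<beta> Z + \<gamma> Y) + s * (\<alpha> Y + \<beta> X) + r * (\<alpha> Z + \<gamma> X)"
      using V' \<alpha> \<alpha>X by (simp add: u w lin scaleR_fun_apply algebra_simps)
    also have "\<dots> = 0"
      using perp[OF YZ(1)] perp[OF YZ(2)] isotropic_pairing[OF iW YZ] by simp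
    finally show "pairing u w = 0" .
  qed
  moreover have "W' \<subseteq> V \<times> dual_space V"
    unfolding W'_def using WE X \<alpha> V subspace_dual_space
    by (intro span_minimal subspace_Times) auto
  moreover have "W \<subseteq> W'" "(X, \<alpha>) \<in> W'"
    unfolding W'_def by (auto intro: span_base)
  ultimately show ?thesis
    using max[of W'] subspace_span[of "insert (X, \<alpha>) W"] unfolding W'_def by metis
qed

text \<open>Recovers the fibre of \<open>L\<close> from \<open>(F, \<Omega>\<^sub>F)\<close>.
  Isotropy gives one direction; maximality gives the other, because it forces \<open>L\<close> to
  contain the annihilator of \<open>F\<close>.\<close>

lemma maximal_isotropic_mem_iff:
  fixes L :: "('p, 'e::real_normed_vector) fibres"
  assumes V: "subspace V" and W: "maximal_isotropic (V \<times> dual_space V) (L p)"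
    and \<alpha>: "\<alpha> \<in> dual_space V"
  shows "(X, \<alpha>) \<in> L p \<longleftrightarrow> X \<in> assoc_dist L p \<and> (\<forall>Y\<in>assoc_dist L p. assoc_form L p X Y = - \<alpha> Y)"
proof
  have iW: "isotropic (L p)" and sW: "subspace (L p)" and WE: "L p \<subseteq> V \<times> dual_space V"
    using W unfolding maximal_isotropic_def by auto
  {
    assume "(X, \<alpha>) \<in> L p"
    then show "X \<in> assoc_dist L p \<and> (\<forall>Y\<in>assoc_dist L p. assoc_form L p X Y = - \<alpha> Y)"
      using assoc_form_eq[where L=L, OF iW] by (force simp: assoc_dist_def)
  }
  assume R: "X \<in> assoc_dist L p \<and> (\<forall>Y\<in>assoc_dist L p. assoc_form L p X Y = - \<alpha> Y)"
  then obtain \<gamma> where \<gamma>: "(X, \<gamma>) \<in> L p"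
    by (auto simp: assoc_dist_def)
  then have \<gamma>V: "\<gamma> \<in> dual_space V"
    using WE by auto
  have eq: "\<alpha> Y = \<gamma> Y" if "Y \<in> assoc_dist L p" for Y
    using R that assoc_form_eq[where L=L, OF iW \<gamma> that] by force
  \<comment> \<open>Both covectors restrict to the same functional on \<open>F\<close>, so their
    difference pairs to zero with every element of \<open>L p\<close>.\<close>
  have "(0, \<alpha> - \<gamma>) \<in> L p"
  proof (rule maximal_isotropic_memI[OF V W])
    show "0 \<in> V" using V by (rule subspace_0)
    show "\<alpha> - \<gamma> \<in> dual_space V"
      using subspace_diff[OF subspace_dual_space \<alpha> \<gamma>V] .
    show "(\<alpha> - \<gamma>) 0 = 0"
      using dual_space_scale[OF \<alpha> \<open>0 \<in> V\<close>, of 0] dual_space_scale[OF \<gamma>V \<open>0 \<in> V\<close>, of 0] by simp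
    show "(\<alpha> - \<gamma>) Y + \<beta> 0 = 0" if "(Y, \<beta>) \<in> L p" for Y \<beta>
    proof -
      have "Y \<in> assoc_dist L p" "\<beta> \<in> dual_space V"
        using that WE by (force simp: assoc_dist_def)+
      then show ?thesis
        using eq dual_space_scale[of \<beta> V 0 0] \<open>0 \<in> V\<close> by simp
    qed
  qed
  from subspace_add[OF sW this \<gamma>] show "(X, \<alpha>) \<in> L p"
    by simp
qed

text \<open>By the membership criterion, \<open>(X, 0)\<close> in \<open>L\<close> says that
  \<open>X\<close> is in the kernel of \<open>\<Omega>\<^sub>F\<close>.\<close>

lemma nondegenerate_zero_covector:
  fixes L :: "('p, 'e::real_normed_vector) fibres"
  assumes V: "subspace V" and W: "maximal_isotropic (V \<times> dual_space V) (L p)"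
    and "nondegenerate_on (assoc_dist L p) (assoc_form L p)" and "(X, 0) \<in> L p"
  shows "X = 0"
  using assms(3,4) maximal_isotropic_mem_iff[where L=L, OF V W subspace_0[OF subspace_dual_space]]
  unfolding nondegenerate_on_def by auto

lemma nondegenerate_unique:
  fixes L :: "('p, 'e::real_normed_vector) fibres"
  assumes V: "subspace V" and W: "maximal_isotropic (V \<times> dual_space V) (L p)"
    and "nondegenerate_on (assoc_dist L p) (assoc_form L p)"
    and "(X, \<alpha>) \<in> L p" "(Y, \<alpha>) \<in> L p"
  shows "X = Y"
proof -
  have "subspace (L p)"
    using W unfolding maximal_isotropic_def by auto
  from subspace_diff[OF this assms(4,5)] have "(X - Y, 0) \<in> L p"
    by simp
  then show ?thesis
    using nondegenerate_zero_covector[where L=L, OF assms(1-3)] by fastforce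
qed

text \<open>A vector annihilated by all the \<open>\<alpha> i\<close> is orthogonal to \<open>L p\<close>, so it lies in \<open>L p\<close> by
  maximality and is zero by nondegeneracy.\<close>

lemma nondegenerate_covectors_span:
  fixes L :: "('p, 'e::real_normed_vector) fibres"
    and X :: "nat \<Rightarrow> ('p, 'e) tvec" and \<alpha> :: "nat \<Rightarrow> ('p, 'e) covec"
  assumes V: "subspace V" and W: "maximal_isotropic (V \<times> dual_space V) (L p)"
    and nd: "nondegenerate_on (assoc_dist L p) (assoc_form L p)"
    and span: "span ((\<lambda>i. (X i, \<alpha> i)) ` {..<k}) = L p"
    and \<beta>: "\<beta> \<in> dual_space V"
  obtains c where "\<beta> = (\<Sum>i<k. c i *\<^sub>R \<alpha> i)" "(\<Sum>i<k. c i *\<^sub>R X i, \<beta>) \<in> L p"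
proof -
  have sW: "subspace (L p)" and WE: "L p \<subseteq> V \<times> dual_space V"
    using W unfolding maximal_isotropic_def by auto
  have Xa: "(X i, \<alpha> i) \<in> L p" if "i < k" for i
    unfolding span[symmetric] using that by (intro span_base) auto
  have \<alpha>: "\<alpha> i \<in> dual_space V" if "i < k" for i
    using Xa[OF that] WE by auto
  have zero: "x = 0" if x: "x \<in> V" "\<And>i. i < k \<Longrightarrow> \<alpha> i x = 0" for x
  proof (rule nondegenerate_zero_covector[where L=L, OF V W nd], rule maximal_isotropic_memI[OF V W x(1)])
    show "0 \<in> dual_space V" by (rule subspace_0[OF subspace_dual_space])
    \<comment> \<open>Vanishing of the covector part at \<open>x\<close> is a linear condition, so
      it passes from the generators to their span \<open>L p\<close>.\<close>
    have sub: "subspace {u \<in> V \<times> dual_space V. snd u x = 0}"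
      using subspace_Times[OF V subspace_dual_space[of V]]
      unfolding subspace_def by (auto simp: scaleR_fun_apply)
    have "L p \<subseteq> {u \<in> V \<times> dual_space V. snd u x = 0}"
      unfolding span[symmetric] using Xa WE x(2) by (intro span_minimal sub) auto
    then show "0 Y + \<beta> x = 0" if "(Y, \<beta>) \<in> L p" for Y \<beta>
      using that by auto
  qed simp
  have \<beta>0: "\<beta> 0 = 0"
    using dual_space_scale[OF \<beta> subspace_0[OF V], of 0] by simp
  have vanish: "\<beta> x = 0" if "x \<in> V" "\<And>i. i < k \<Longrightarrow> \<alpha> i x = 0" for x
    using zero[OF that] \<beta>0 by simp
  then obtain c where c: "\<forall>x\<in>V. \<beta> x = (\<Sum>i<k. c i * \<alpha> i x)"
    using functional_combination[where f = \<alpha> and k = k, OF V \<alpha> \<beta> vanish] by blast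
  have "(\<Sum>i<k. c i *\<^sub>R \<alpha> i) \<in> dual_space V"
    using \<alpha> by (intro subspace_sum subspace_scale subspace_dual_space) auto
  then have eq: "\<beta> = (\<Sum>i<k. c i *\<^sub>R \<alpha> i)"
    using c by (intro dual_space_eqI[OF \<beta>]) (simp_all add: sum_scaleR_fun_apply)
  \<comment> \<open>The same coefficients, applied to the pairs, give an element of
    \<open>L p\<close> lying over \<beta>.\<close>
  have "(\<Sum>i<k. c i *\<^sub>R (X i, \<alpha> i)) \<in> L p"
    using Xa sW by (intro subspace_sum subspace_scale) auto
  then show thesis
    using that[OF eq] eq unfolding sum_scaleR_pair by simp
qed

section \<open>Charts and tangent spaces\<close>

lemma open_chart_image:
  assumes "is_chart c" "open U"
  shows "open (snd c ` (U \<inter> fst c))"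
proof -
  have "openin (top_of_set (fst c)) (U \<inter> fst c)"
    using assms(2) by (metis inf_commute openin_open_Int)
  then have "openin (top_of_set (snd c ` fst c)) (snd c ` (U \<inter> fst c))"
    using assms(1) homeomorphism_imp_open_map unfolding is_chart_def by blast
  then show ?thesis
    using assms(1) openin_open_trans unfolding is_chart_def by blast
qed

lemma chart_inv_eq: "is_chart c \<Longrightarrow> p \<in> fst c \<Longrightarrow> chart_inv c (snd c p) = p"
  unfolding is_chart_def by (meson homeomorphism_def)

lemma smooth_manifold_chart: "smooth_manifold A \<Longrightarrow> c \<in> A \<Longrightarrow> is_chart c"
  unfolding smooth_manifold_def by blast

lemma transition_apply: "is_chart c \<Longrightarrow> p \<in> fst c \<Longrightarrow> transition c d (snd c p) = snd d p"
  by (simp add: transition_def chart_inv_eq)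

lemma transition_has_derivative:
  assumes "smooth_manifold A" "c \<in> A" "d \<in> A" "p \<in> fst c" "p \<in> fst d"
  shows "(transition c d has_derivative frechet_derivative (transition c d) (at (snd c p))) (at (snd c p))"
proof -
  have "smooth_on (snd c ` (fst c \<inter> fst d)) (transition c d)"
    using assms unfolding smooth_manifold_def by blast
  then show ?thesis
    using assms(4,5) by (intro Ck_on_Suc_deriv[OF smooth_onD]) auto
qed

lemma linear_frechet_transition:
  assumes "smooth_manifold A" "c \<in> A" "d \<in> A" "p \<in> fst c" "p \<in> fst d"
  shows "linear (frechet_derivative (transition c d) (at (snd c p)))"
  using has_derivative_linear[OF transition_has_derivative[OF assms]] .

lemma frechet_transition_self:
  assumes "is_chart c" "p \<in> fst c"
  shows "frechet_derivative (transition c c) (at (snd c p)) v = v"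
proof -
  have "(transition c c has_derivative (\<lambda>v. v)) (at (snd c p))"
  proof (rule has_derivative_transform_within_open[OF has_derivative_ident])
    show "open (snd c ` (UNIV \<inter> fst c))"
      using open_chart_image[OF assms(1)] by blast
  qed (use assms in \<open>auto simp: transition_apply\<close>)
  from frechet_derivative_at[OF this] show ?thesis
    by metis
qed

text \<open>The cocycle identity, from the chain rule: the composite agrees with the direct
  transition map on the image of the triple overlap, an open neighbourhood of
  \<open>snd c p\<close>.\<close>

lemma frechet_transition_compose:
  assumes A: "smooth_manifold A" and cde: "c \<in> A" "d \<in> A" "e \<in> A"
    and p: "p \<in> fst c" "p \<in> fst d" "p \<in> fst e"
  shows "frechet_derivative (transition c e) (at (snd c p)) v =
    frechet_derivative (transition d e) (at (snd d p))
      (frechet_derivative (transition c d) (at (snd c p)) v)"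
proof -
  note c = smooth_manifold_chart[OF A cde(1)] and d = smooth_manifold_chart[OF A cde(2)]
    and e = smooth_manifold_chart[OF A cde(3)]
  let ?D = "\<lambda>v. frechet_derivative (transition d e) (at (snd d p))
      (frechet_derivative (transition c d) (at (snd c p)) v)"
  have "((\<lambda>x. transition d e (transition c d x)) has_derivative ?D) (at (snd c p))"
    using has_derivative_compose[OF transition_has_derivative[OF A cde(1,2) p(1,2)],
        of "transition d e" "frechet_derivative (transition d e) (at (snd d p))"]
      transition_has_derivative[OF A cde(2,3) p(2,3)] transition_apply[OF c p(1)] by simp
  then have "(transition c e has_derivative ?D) (at (snd c p))"
  proof (rule has_derivative_transform_within_open)
    show "open (snd c ` ((fst d \<inter> fst e) \<inter> fst c))"
      using d e by (intro open_chart_image[OF c] open_Int) (auto simp: is_chart_def)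
  qed (use p c d in \<open>auto simp: transition_apply\<close>)
  from frechet_derivative_at[OF this] show ?thesis
    by metis
qed

section \<open>Tangent vectors and their components in a chart\<close>

lemma tangent_spaceI:
  assumes "\<And>c d. c \<in> A \<Longrightarrow> d \<in> A \<Longrightarrow> p \<in> fst c \<Longrightarrow> p \<in> fst d \<Longrightarrow>
      v d = frechet_derivative (transition c d) (at (snd c p)) (v c)"
    and "\<And>c. \<not> (c \<in> A \<and> p \<in> fst c) \<Longrightarrow> v c = 0"
  shows "v \<in> tangent_space A p"
  unfolding tangent_space_def using assms by blast

lemma tangent_spaceD:
  assumes "v \<in> tangent_space A p"
  shows "c \<in> A \<Longrightarrow> d \<in> A \<Longrightarrow> p \<in> fst c \<Longrightarrow> p \<in> fst d \<Longrightarrow>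
      v d = frechet_derivative (transition c d) (at (snd c p)) (v c)"
    and "\<not> (c \<in> A \<and> p \<in> fst c) \<Longrightarrow> v c = 0"
  using assms unfolding tangent_space_def by blast+

lemma subspace_tangent_space:
  assumes "smooth_manifold A"
  shows "subspace (tangent_space A p)"
proof -
  note lin = linear_frechet_transition[OF assms]
  have "0 \<in> tangent_space A p"
    by (rule tangent_spaceI) (simp_all add: linear_0[OF lin])
  moreover have "v + w \<in> tangent_space A p"
    if v: "v \<in> tangent_space A p" and w: "w \<in> tangent_space A p" for v w
  proof (rule tangent_spaceI)
    show "(v + w) d = frechet_derivative (transition c d) (at (snd c p)) ((v + w) c)"
      if "c \<in> A" "d \<in> A" "p \<in> fst c" "p \<in> fst d" for c d
      unfolding plus_fun_apply linear_add[OF lin[OF that]]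
      by (rule arg_cong2[OF tangent_spaceD(1)[OF v that] tangent_spaceD(1)[OF w that]])
    show "(v + w) c = 0" if "\<not> (c \<in> A \<and> p \<in> fst c)" for c
      by (simp add: tangent_spaceD(2)[OF v that] tangent_spaceD(2)[OF w that])
  qed
  moreover have "r *\<^sub>R v \<in> tangent_space A p" if v: "v \<in> tangent_space A p" for r v
  proof (rule tangent_spaceI)
    show "(r *\<^sub>R v) d = frechet_derivative (transition c d) (at (snd c p)) ((r *\<^sub>R v) c)"
      if "c \<in> A" "d \<in> A" "p \<in> fst c" "p \<in> fst d" for c d
      unfolding scaleR_fun_apply linear_scale[OF lin[OF that]]
      by (rule arg_cong[OF tangent_spaceD(1)[OF v that]])
    show "(r *\<^sub>R v) c = 0" if "\<not> (c \<in> A \<and> p \<in> fst c)" for c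
      by (simp add: scaleR_fun_apply tangent_spaceD(2)[OF v that])
  qed
  ultimately show ?thesis
    unfolding subspace_def by blast
qed

text \<open>One component determines the others. With the next two lemmas, \<open>coord_vec\<close>
  becomes the inverse of taking the component in \<open>c\<close>, identifying the tangent space
  with the model space.\<close>

lemma tangent_space_eq_coord_vec:
  assumes "v \<in> tangent_space A p" "c \<in> A" "p \<in> fst c"
  shows "coord_vec A c p (v c) = v"
proof
  show "coord_vec A c p (v c) d = v d" for d
    unfolding coord_vec_def
    using tangent_spaceD(1)[OF assms(1,2) _ assms(3), of d] tangent_spaceD(2)[OF assms(1), of d]
    by metis
qed

lemma coord_vec_in_tangent_space:
  assumes "smooth_manifold A" "c \<in> A" "p \<in> fst c"
  shows "coord_vec A c p v \<in> tangent_space A p"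
proof (rule tangent_spaceI)
  show "coord_vec A c p v e = frechet_derivative (transition d e) (at (snd d p)) (coord_vec A c p v d)"
    if de: "d \<in> A" "e \<in> A" "p \<in> fst d" "p \<in> fst e" for d e
  proof -
    have "coord_vec A c p v d = frechet_derivative (transition c d) (at (snd c p)) v"
      and "coord_vec A c p v e = frechet_derivative (transition c e) (at (snd c p)) v"
      using de by (simp_all add: coord_vec_def)
    then show ?thesis
      using frechet_transition_compose[OF assms(1,2) de(1,2) assms(3) de(3,4)] by metis
  qed
  show "coord_vec A c p v d = 0" if "\<not> (d \<in> A \<and> p \<in> fst d)" for d
    unfolding coord_vec_def using that by (rule if_not_P)
qed

lemma coord_vec_apply:
  assumes "smooth_manifold A" "c \<in> A" "p \<in> fst c"
  shows "coord_vec A c p v c = v"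
  unfolding coord_vec_def
  using assms(2,3) frechet_transition_self[OF smooth_manifold_chart[OF assms(1,2)] assms(3)]
  by metis

lemma tangent_space_eqI:
  assumes "v \<in> tangent_space A p" "w \<in> tangent_space A p" "c \<in> A" "p \<in> fst c" "v c = w c"
  shows "v = w"
  using tangent_space_eq_coord_vec[OF assms(1,3,4)] tangent_space_eq_coord_vec[OF assms(2,3,4)] assms(5)
  by metis

section \<open>Covectors in a chart and the sharp map\<close>

lemma coord_covec_in_cotangent_space:
  assumes "smooth_manifold A" "linear \<xi>"
  shows "coord_covec A c p \<xi> \<in> cotangent_space A p"
  unfolding cotangent_space_def
proof (rule dual_spaceI)
  let ?V = "tangent_space A p"
  have V: "subspace ?V"
    using subspace_tangent_space[OF assms(1)] .
  show "coord_covec A c p \<xi> (v + w) = coord_covec A c p \<xi> v + coord_covec A c p \<xi> w"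
    if "v \<in> ?V" "w \<in> ?V" for v w
    using that subspace_add[OF V that] by (simp add: coord_covec_def linear_add[OF assms(2)])
  show "coord_covec A c p \<xi> (r *\<^sub>R v) = r * coord_covec A c p \<xi> v" if "v \<in> ?V" for r v
    using that subspace_scale[OF V that, of r]
    by (simp add: coord_covec_def scaleR_fun_apply linear_scale[OF assms(2)])
  show "coord_covec A c p \<xi> v = 0" if "v \<notin> ?V" for v
    using that by (simp add: coord_covec_def)
qed

lemma cotangent_space_separates:
  fixes A :: "('p::{t2_space, second_countable_topology}, 'e::real_inner) chart set"
  assumes A: "smooth_manifold A" "p \<in> points A"
    and X: "X \<in> tangent_space A p" and Y: "Y \<in> tangent_space A p"
    and eq: "\<And>\<beta>. \<beta> \<in> cotangent_space A p \<Longrightarrow> \<beta> X = \<beta> Y"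
  shows "X = Y"
proof -
  obtain c where c: "c \<in> A" "p \<in> fst c"
    using A(2) by (auto simp: points_def)
  \<comment> \<open>The test covector is the inner product with the difference of the two
    components, which must then have norm zero.\<close>
  have "(X c - Y c) \<bullet> X c = (X c - Y c) \<bullet> Y c"
    using eq[OF coord_covec_in_cotangent_space[OF A(1) bounded_linear.linear[OF bounded_linear_inner_right]], of c "X c - Y c"] X Y
    by (simp add: coord_covec_def)
  then have "(X c - Y c) \<bullet> (X c - Y c) = 0"
    by (simp add: inner_diff_right)
  then show ?thesis
    using tangent_space_eqI[OF X Y c] by simp
qed

text \<open>Covectors separate tangent vectors, so the definite description in \<open>sharp\<close>
  has at most one solution.\<close>

lemma sharp_eqI:
  fixes A :: "('p::{t2_space, second_countable_topology}, 'e::real_inner) chart set"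
  assumes "smooth_manifold A" "p \<in> points A" "X \<in> tangent_space A p"
    and "\<And>\<beta>. \<beta> \<in> cotangent_space A p \<Longrightarrow> \<beta> X = \<pi> p \<alpha> \<beta>"
  shows "sharp A \<pi> p \<alpha> = X"
  unfolding sharp_def
proof (intro the_equality conjI ballI)
  fix Y assume "Y \<in> tangent_space A p \<and> (\<forall>\<beta>\<in>cotangent_space A p. \<beta> Y = \<pi> p \<alpha> \<beta>)"
  then show "Y = X"
    using assms(4) by (intro cotangent_space_separates[OF assms(1,2) _ assms(3)]) simp_all
qed (use assms in auto)

text \<open>Finite dimension enters here: every linear functional is an inner product. Boundedness
  is what makes its composition with a smooth map smooth.\<close>

lemma bounded_linear_smooth_manifold:
  fixes A :: "('p::{t2_space, second_countable_topology}, 'e::real_inner) chart set"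
    and \<eta> :: "'e \<Rightarrow> real"
  assumes "smooth_manifold A" "linear \<eta>"
  shows "bounded_linear \<eta>"
proof -
  obtain B :: "'e set" where "finite B" "span B = UNIV"
    using assms(1) unfolding smooth_manifold_def by blast
  then obtain a where "\<eta> = inner a"
    using linear_functional_eq_inner[OF _ assms(2)] by fastforce
  then show ?thesis
    using bounded_linear_inner_right by blast
qed

section \<open>Almost Dirac structures with nondegenerate form\<close>

lemma almost_DiracD:
  assumes "almost_Dirac A L" "p \<in> points A"
  shows "maximal_isotropic (tangent_space A p \<times> dual_space (tangent_space A p)) (L p)"
    and "subspace (L p)" and "isotropic (L p)" and "L p \<subseteq> tangent_space A p \<times> cotangent_space A p"
  using assms unfolding almost_Dirac_def maximal_isotropic_def cotangent_space_def by auto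

lemma almost_Dirac_frame:
  fixes A :: "('a::topological_space, 'b::real_normed_vector) chart set"
  assumes "almost_Dirac A L" "p \<in> points A"
  obtains U k X \<alpha> where "open U" "p \<in> U" "U \<subseteq> points A"
    "\<forall>i<k::nat. vector_field_on A U (X i) \<and> one_form_on A U (\<alpha> i)"
    "\<forall>q\<in>U. inj_on (\<lambda>i. (X i q, \<alpha> i q)) {..<k} \<and>
      independent ((\<lambda>i. (X i q, \<alpha> i q)) ` {..<k}) \<and>
      span ((\<lambda>i. (X i q, \<alpha> i q)) ` {..<k}) = L q"
proof -
  have "\<forall>p\<in>points A. \<exists>U k. \<exists>X :: nat \<Rightarrow> 'a \<Rightarrow> ('a, 'b) tvec. \<exists>\<alpha> :: nat \<Rightarrow> 'a \<Rightarrow> ('a, 'b) covec.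
      open U \<and> p \<in> U \<and> U \<subseteq> points A \<and>
      (\<forall>i<k. vector_field_on A U (X i) \<and> one_form_on A U (\<alpha> i)) \<and>
      (\<forall>q\<in>U. inj_on (\<lambda>i. (X i q, \<alpha> i q)) {..<k} \<and>
        independent ((\<lambda>i. (X i q, \<alpha> i q)) ` {..<k}) \<and>
        span ((\<lambda>i. (X i q, \<alpha> i q)) ` {..<k}) = L q)"
    using assms(1) unfolding almost_Dirac_def smooth_subbundle_def by (elim conjE)
  from bspec[OF this assms(2)] show thesis
    by (elim exE conjE) (rule that)
qed

text \<open>The vector \<open>X\<close> corresponding to a covector \<open>\<alpha>\<close>, that is, the value of \<open>\<pi>\<^sup>\<sharp>\<close> at \<open>\<alpha>\<close>.\<close>

definition Dirac_vec :: "('p, 'e) fibres \<Rightarrow> 'p \<Rightarrow> ('p, 'e) covec \<Rightarrow> ('p, 'e) tvec"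
  where "Dirac_vec L p \<alpha> = (THE X. (X, \<alpha>) \<in> L p)"

section \<open>The bivector field of a nondegenerate structure\<close>

context
  fixes A :: "('p::{t2_space, second_countable_topology}, 'e::real_inner) chart set"
    and L :: "('p, 'e) fibres"
  assumes A: "smooth_manifold A" and L: "almost_Dirac A L"
    and nondeg: "\<And>p. p \<in> points A \<Longrightarrow> nondegenerate_on (assoc_dist L p) (assoc_form L p)"
begin

lemma Dirac_vec_eqI:
  assumes p: "p \<in> points A" and X: "(X, \<alpha>) \<in> L p"
  shows "Dirac_vec L p \<alpha> = X"
  unfolding Dirac_vec_def
proof (rule the_equality)
  show "Y = X" if "(Y, \<alpha>) \<in> L p" for Y
    using subspace_tangent_space[OF A] almost_DiracD(1)[OF L p] nondeg[OF p] that X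
    by (rule nondegenerate_unique[where L=L])
qed (rule X)

text \<open>Existence behind the definite description: expanding \<alpha> in the covector parts of a
  local frame produces a vector paired with it in \<open>L p\<close>.\<close>

lemma Dirac_vec_mem:
  assumes p: "p \<in> points A" and \<alpha>: "\<alpha> \<in> cotangent_space A p"
  shows "(Dirac_vec L p \<alpha>, \<alpha>) \<in> L p"
proof -
  obtain U k X \<gamma> where "p \<in> U" "\<forall>q\<in>U. inj_on (\<lambda>i. (X i q, \<gamma> i q)) {..<k} \<and>
      independent ((\<lambda>i. (X i q, \<gamma> i q)) ` {..<k}) \<and>
      span ((\<lambda>i. (X i q, \<gamma> i q)) ` {..<k::nat}) = L q"
    by (rule almost_Dirac_frame[OF L p])
  then have span: "span ((\<lambda>i. (X i p, \<gamma> i p)) ` {..<k}) = L p"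
    by blast
  have "\<alpha> \<in> dual_space (tangent_space A p)"
    using \<alpha> unfolding cotangent_space_def .
  then obtain c :: "nat \<Rightarrow> real" where "(\<Sum>i<k. c i *\<^sub>R X i p, \<alpha>) \<in> L p"
    by (rule nondegenerate_covectors_span[where L=L, OF subspace_tangent_space[OF A]
        almost_DiracD(1)[OF L p] nondeg[OF p] span])
  then show ?thesis
    using Dirac_vec_eqI[OF p] by simp
qed

lemma Dirac_vec_tangent:
  assumes "p \<in> points A" "\<alpha> \<in> cotangent_space A p"
  shows "Dirac_vec L p \<alpha> \<in> tangent_space A p"
  using Dirac_vec_mem[OF assms] almost_DiracD(4)[OF L assms(1)] by auto

lemma Dirac_vec_add:
  assumes "p \<in> points A" "\<alpha> \<in> cotangent_space A p" "\<beta> \<in> cotangent_space A p"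
  shows "Dirac_vec L p (\<alpha> + \<beta>) = Dirac_vec L p \<alpha> + Dirac_vec L p \<beta>"
  using subspace_add[OF almost_DiracD(2)[OF L assms(1)] Dirac_vec_mem[OF assms(1,2)] Dirac_vec_mem[OF assms(1,3)]]
  by (intro Dirac_vec_eqI[OF assms(1)]) simp

lemma Dirac_vec_scale:
  assumes "p \<in> points A" "\<alpha> \<in> cotangent_space A p"
  shows "Dirac_vec L p (r *\<^sub>R \<alpha>) = r *\<^sub>R Dirac_vec L p \<alpha>"
  using subspace_scale[OF almost_DiracD(2)[OF L assms(1)] Dirac_vec_mem[OF assms(1,2)], of r]
  by (intro Dirac_vec_eqI[OF assms(1)]) simp

lemma alternating_Dirac_vec:
  assumes p: "p \<in> points A"
  shows "alternating_form_on (cotangent_space A p) (\<lambda>\<alpha> \<beta>. \<beta> (Dirac_vec L p \<alpha>))"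
proof -
  \<comment> \<open>The pairing of an element of \<open>L p\<close> with itself is twice this
    value.\<close>
  have "\<alpha> (Dirac_vec L p \<alpha>) = 0" if "\<alpha> \<in> cotangent_space A p" for \<alpha>
    using isotropic_pairing[OF almost_DiracD(3)[OF L p] Dirac_vec_mem[OF p that] Dirac_vec_mem[OF p that]]
    by simp
  then show ?thesis
    using Dirac_vec_tangent[OF p]
    unfolding alternating_form_on_def cotangent_space_def
    by (simp add: Dirac_vec_add[OF p] Dirac_vec_scale[OF p] cotangent_space_def
        dual_space_add dual_space_scale scaleR_fun_apply)
qed

text \<open>The coefficients of the constant covector \<xi> in the local coframe solve a smooth
  linear system, hence are smooth. The same coefficients express the corresponding vector through
  the smooth fields \<open>X i\<close>, to which \<eta> is then applied.\<close>

lemma smooth_at_Dirac_vec: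
  assumes c: "c \<in> A" and \<xi>: "linear \<xi>" and \<eta>: "linear \<eta>" and x0: "x0 \<in> snd c ` fst c"
  shows "smooth_at x0 (\<lambda>x. coord_covec A c (chart_inv c x) \<eta>
      (Dirac_vec L (chart_inv c x) (coord_covec A c (chart_inv c x) \<xi>)))"
proof -
  define q where "q = chart_inv c"
  have chart: "is_chart c"
    using smooth_manifold_chart[OF A c] .
  have q_snd: "q (snd c p) = p" if "p \<in> fst c" for p
    unfolding q_def using chart_inv_eq[OF chart that] .
  have qx0: "q x0 \<in> fst c"
    using x0 q_snd by auto
  then have "q x0 \<in> points A"
    using c by (auto simp: points_def)
  then obtain U k X \<alpha> where U: "open U" "q x0 \<in> U" "U \<subseteq> points A"
    and X\<alpha>: "\<forall>i<k. vector_field_on A U (X i) \<and> one_form_on A U (\<alpha> i)"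
    and frame: "\<forall>p\<in>U. inj_on (\<lambda>i. (X i p, \<alpha> i p)) {..<k} \<and>
      independent ((\<lambda>i. (X i p, \<alpha> i p)) ` {..<k::nat}) \<and>
      span ((\<lambda>i. (X i p, \<alpha> i p)) ` {..<k}) = L p"
    by (rule almost_Dirac_frame[OF L])
  have X: "vector_field_on A U (X i)" and \<alpha>: "one_form_on A U (\<alpha> i)" if "i < k" for i
    using X\<alpha> that by auto
  have inj: "inj_on (\<lambda>i. (X i p, \<alpha> i p)) {..<k}"
    and indep: "independent ((\<lambda>i. (X i p, \<alpha> i p)) ` {..<k})"
    and span: "span ((\<lambda>i. (X i p, \<alpha> i p)) ` {..<k}) = L p" if "p \<in> U" for p
    using frame that by blast+
  define N where "N = snd c ` (U \<inter> fst c)"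
  have N: "open N"
    unfolding N_def using open_chart_image[OF chart U(1)] .
  have qN: "q x \<in> U" "q x \<in> fst c" "q x \<in> points A" if "x \<in> N" for x
    using that q_snd U(3) by (auto simp: N_def)
  have x0N: "x0 \<in> N"
    using x0 q_snd U(2) by (auto simp: N_def)
  have evN: "\<forall>\<^sub>F x in nhds x0. x \<in> N"
    using N x0N by (rule eventually_nhds_in_open)
  \<comment> \<open>The coefficients are first chosen point by point, with no regularity; their
    smoothness is proved afterwards.\<close>
  have "\<forall>x\<in>N. \<exists>a. coord_covec A c (q x) \<xi> = (\<Sum>i<k. a i *\<^sub>R \<alpha> i (q x)) \<and>
      (\<Sum>i<k. a i *\<^sub>R X i (q x), coord_covec A c (q x) \<xi>) \<in> L (q x)"
  proof
    fix x assume x: "x \<in> N"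
    have "coord_covec A c (q x) \<xi> \<in> dual_space (tangent_space A (q x))"
      using coord_covec_in_cotangent_space[OF A \<xi>] unfolding cotangent_space_def .
    then obtain a where "coord_covec A c (q x) \<xi> = (\<Sum>i<k. a i *\<^sub>R \<alpha> i (q x))"
      "(\<Sum>i<k. a i *\<^sub>R X i (q x), coord_covec A c (q x) \<xi>) \<in> L (q x)"
      by (rule nondegenerate_covectors_span[where L=L, OF subspace_tangent_space[OF A]
          almost_DiracD(1)[OF L qN(3)[OF x]] nondeg[OF qN(3)[OF x]] span[OF qN(1)[OF x]]])
    then show "\<exists>a. coord_covec A c (q x) \<xi> = (\<Sum>i<k. a i *\<^sub>R \<alpha> i (q x)) \<and>
      (\<Sum>i<k. a i *\<^sub>R X i (q x), coord_covec A c (q x) \<xi>) \<in> L (q x)"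
      by (intro exI[of _ a] conjI)
  qed
  from bchoice[OF this] obtain a where aN: "\<forall>x\<in>N. coord_covec A c (q x) \<xi> = (\<Sum>i<k. a x i *\<^sub>R \<alpha> i (q x)) \<and>
      (\<Sum>i<k. a x i *\<^sub>R X i (q x), coord_covec A c (q x) \<xi>) \<in> L (q x)"
    by (rule exE)
  have a: "coord_covec A c (q x) \<xi> = (\<Sum>i<k. a x i *\<^sub>R \<alpha> i (q x))"
      "(\<Sum>i<k. a x i *\<^sub>R X i (q x), coord_covec A c (q x) \<xi>) \<in> L (q x)" if "x \<in> N" for x
    using bspec[OF aN that] by (rule conjunct1, rule conjunct2)
  \<comment> \<open>There is one equation for each vector \<open>v\<close> of the model space,
    obtained by evaluating the expansion on the coordinate vector of \<open>v\<close>; its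
    right-hand side is the constant \<open>\<xi> v\<close>.\<close>
  have a_smooth: "smooth_at x0 (\<lambda>x. a x i)" if "i < k" for i
  proof (rule smooth_at_linear_system[where M = "\<lambda>i v x. \<alpha> i (q x) (coord_vec A c (q x) v)"
        and b = "\<lambda>v x. \<xi> v" and k = k])
    show "smooth_at x0 (\<lambda>x. \<alpha> i (q x) (coord_vec A c (q x) v))" if "i < k" for i v
      using \<alpha>[OF that] c unfolding one_form_on_def q_def
      by (intro smooth_on_imp_smooth_at[OF _ N x0N]) (auto simp: N_def)
    show "smooth_at x0 (\<lambda>x. \<xi> v)" for v
      by (rule smooth_at_const)
    show "\<forall>\<^sub>F x in nhds x0. (\<Sum>i<k. a x i * \<alpha> i (q x) (coord_vec A c (q x) v)) = \<xi> v" for v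
      using evN
    proof eventually_elim
      case (elim x)
      have "(\<Sum>i<k. a x i * \<alpha> i (q x) (coord_vec A c (q x) v)) = coord_covec A c (q x) \<xi> (coord_vec A c (q x) v)"
        by (simp add: a(1)[OF elim] sum_scaleR_fun_apply)
      then show ?case
        using coord_vec_in_tangent_space[OF A c qN(2)[OF elim]] coord_vec_apply[OF A c qN(2)[OF elim]]
        by (simp add: coord_covec_def)
    qed
    \<comment> \<open>A relation among the covector parts gives an element of \<open>L\<close> with
      zero covector. Nondegeneracy kills its vector part too, so the relation holds for the whole
      frame and must be trivial.\<close>
    show "e i = 0" if e: "\<And>v. (\<Sum>i<k. e i * \<alpha> i (q x0) (coord_vec A c (q x0) v)) = 0" and "i < k" for e i
    proof -
      note p = qN[OF x0N]
      have mem: "(X i (q x0), \<alpha> i (q x0)) \<in> L (q x0)" if "i < k" for i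
        unfolding span[OF p(1), symmetric] using that by (intro span_base) auto
      have "(\<Sum>i<k. e i *\<^sub>R \<alpha> i (q x0)) = 0"
      proof (rule dual_space_eqI)
        show "(\<Sum>i<k. e i *\<^sub>R \<alpha> i (q x0)) \<in> dual_space (tangent_space A (q x0))"
          using mem almost_DiracD(4)[OF L p(3)] unfolding cotangent_space_def
          by (intro subspace_sum subspace_scale subspace_dual_space) auto
        show "0 \<in> dual_space (tangent_space A (q x0))"
          by (rule subspace_0[OF subspace_dual_space])
        show "(\<Sum>i<k. e i *\<^sub>R \<alpha> i (q x0)) v = 0 v" if "v \<in> tangent_space A (q x0)" for v
          using e[of "v c"] tangent_space_eq_coord_vec[OF that c p(2)]
          by (simp add: sum_scaleR_fun_apply)
      qed
      moreover have "(\<Sum>i<k. e i *\<^sub>R (X i (q x0), \<alpha> i (q x0))) \<in> L (q x0)"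
        using mem by (intro subspace_sum subspace_scale almost_DiracD(2)[OF L p(3)]) auto
      ultimately have "(\<Sum>i<k. e i *\<^sub>R (X i (q x0), \<alpha> i (q x0))) = 0"
        using nondegenerate_zero_covector[where L=L, OF subspace_tangent_space[OF A]
            almost_DiracD(1)[OF L p(3)] nondeg[OF p(3)]]
        unfolding sum_scaleR_pair by (simp add: zero_prod_def)
      then show ?thesis
        using independent_family_coeff_zero[OF inj[OF p(1)] indep[OF p(1)]] \<open>i < k\<close> by simp
    qed
  qed fact
  have "smooth_at x0 (\<lambda>x. \<Sum>i<k. a x i * \<eta> (X i (q x) c))"
  proof (intro smooth_at_sum smooth_at_mult smooth_at_bounded_linear[OF bounded_linear_smooth_manifold[OF A \<eta>]])
    fix i assume "i \<in> {..<k}"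
    then have i: "i < k" by simp
    then show "smooth_at x0 (\<lambda>x. a x i)"
      by (rule a_smooth)
    have "smooth_on N (\<lambda>x. X i (q x) c)"
      using X[OF i] c unfolding vector_field_on_def q_def N_def by blast
    then show "smooth_at x0 (\<lambda>x. X i (q x) c)"
      using N x0N by (rule smooth_on_imp_smooth_at)
  qed
  moreover have "\<forall>\<^sub>F x in nhds x0. (\<Sum>i<k. a x i * \<eta> (X i (q x) c))
      = coord_covec A c (q x) \<eta> (Dirac_vec L (q x) (coord_covec A c (q x) \<xi>))"
    using evN
  proof eventually_elim
    case (elim x)
    have D: "Dirac_vec L (q x) (coord_covec A c (q x) \<xi>) = (\<Sum>i<k. a x i *\<^sub>R X i (q x))"
      using Dirac_vec_eqI[OF qN(3)[OF elim] a(2)[OF elim]] .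
    have "(\<Sum>i<k. a x i *\<^sub>R X i (q x)) \<in> tangent_space A (q x)"
      using a(2)[OF elim] almost_DiracD(4)[OF L qN(3)[OF elim]] by auto
    then show ?case
      unfolding D by (simp add: coord_covec_def sum_scaleR_fun_apply linear_sum[OF \<eta>] linear_scale[OF \<eta>])
  qed
  ultimately show ?thesis
    unfolding q_def by (rule smooth_at_cong)
qed

lemma bivector_field_Dirac_vec: "bivector_field A (\<lambda>p \<alpha> \<beta>. \<beta> (Dirac_vec L p \<alpha>))"
  unfolding bivector_field_def
proof (intro conjI ballI allI impI)
  show "alternating_form_on (cotangent_space A p) (\<lambda>\<alpha> \<beta>. \<beta> (Dirac_vec L p \<alpha>))"
    if "p \<in> points A" for p
    using that by (rule alternating_Dirac_vec)
  show "smooth_on (snd c ` fst c) (\<lambda>x. coord_covec A c (chart_inv c x) \<eta>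
      (Dirac_vec L (chart_inv c x) (coord_covec A c (chart_inv c x) \<xi>)))"
    if "c \<in> A" "linear \<xi> \<and> linear \<eta>" for c \<xi> \<eta>
    using that smooth_at_Dirac_vec by (intro smooth_on_if_smooth_at) blast
qed

text \<open>For this bivector field \<open>sharp\<close> coincides with \<open>Dirac_vec\<close> on
  covectors, and \<open>L\<close> is the graph of \<open>Dirac_vec\<close> by existence and
  uniqueness of the vector over each covector.\<close>

lemma is_graph_of_Dirac_vec: "is_graph_of A L (\<lambda>p \<alpha> \<beta>. \<beta> (Dirac_vec L p \<alpha>))"
  unfolding is_graph_of_def
proof (intro ballI)
  fix p assume p: "p \<in> points A"
  have sharp: "sharp A (\<lambda>p \<alpha> \<beta>. \<beta> (Dirac_vec L p \<alpha>)) p \<alpha> = Dirac_vec L p \<alpha>"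
    if "\<alpha> \<in> cotangent_space A p" for \<alpha>
    using sharp_eqI[OF A p Dirac_vec_tangent[OF p that]] by simp
  have "(X, \<alpha>) \<in> L p \<longleftrightarrow>
      \<alpha> \<in> cotangent_space A p \<and> X = sharp A (\<lambda>p \<alpha> \<beta>. \<beta> (Dirac_vec L p \<alpha>)) p \<alpha>" for X \<alpha>
  proof
    assume X: "(X, \<alpha>) \<in> L p"
    then have "\<alpha> \<in> cotangent_space A p"
      using almost_DiracD(4)[OF L p] by auto
    then show "\<alpha> \<in> cotangent_space A p \<and> X = sharp A (\<lambda>p \<alpha> \<beta>. \<beta> (Dirac_vec L p \<alpha>)) p \<alpha>"
      using sharp Dirac_vec_eqI[OF p X] by simp
  next
    assume "\<alpha> \<in> cotangent_space A p \<and> X = sharp A (\<lambda>p \<alpha> \<beta>. \<beta> (Dirac_vec L p \<alpha>)) p \<alpha>"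
    then show "(X, \<alpha>) \<in> L p"
      using sharp Dirac_vec_mem[OF p] by metis
  qed
  then show "L p = {(sharp A (\<lambda>p \<alpha> \<beta>. \<beta> (Dirac_vec L p \<alpha>)) p \<alpha>, \<alpha>) | \<alpha>. \<alpha> \<in> cotangent_space A p}"
    by auto
qed

end

section \<open>From a graph back to nondegeneracy, and the explicit relation\<close>

lemma is_graph_ofD:
  assumes "is_graph_of A L \<pi>" "p \<in> points A"
  shows "(X, \<alpha>) \<in> L p \<longleftrightarrow> \<alpha> \<in> cotangent_space A p \<and> X = sharp A \<pi> p \<alpha>"
  using assms unfolding is_graph_of_def by auto

text \<open>A vector \<open>X\<close> in the kernel of \<open>\<Omega>\<^sub>F\<close> gives
  \<open>(X, 0)\<close> in \<open>L\<close>. A graph has a single vector over the zero covector, and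
  \<open>(0, 0)\<close> already lies in \<open>L\<close>.\<close>

lemma graph_nondegenerate:
  assumes A: "smooth_manifold A" and L: "almost_Dirac A L" and G: "is_graph_of A L \<pi>"
    and p: "p \<in> points A"
  shows "nondegenerate_on (assoc_dist L p) (assoc_form L p)"
proof -
  note D = almost_DiracD[OF L p]
  have zero: "X = 0" if XF: "X \<in> assoc_dist L p" and X: "\<And>Y. Y \<in> assoc_dist L p \<Longrightarrow> assoc_form L p X Y = 0" for X
  proof -
    have "\<forall>Y\<in>assoc_dist L p. assoc_form L p X Y = - 0 Y"
      using X by simp
    then have "(X, 0) \<in> L p"
      using maximal_isotropic_mem_iff[where L=L, OF subspace_tangent_space[OF A] D(1) subspace_0[OF subspace_dual_space]] XF
      by blast
    then have "X = sharp A \<pi> p 0"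
      using is_graph_ofD[OF G p] by blast
    moreover have "(0, 0) \<in> L p"
      using subspace_0[OF D(2)] by (simp add: zero_prod_def)
    then have "0 = sharp A \<pi> p 0"
      using is_graph_ofD[OF G p] by blast
    ultimately show ?thesis by simp
  qed
  \<comment> \<open>Isotropy makes \<open>\<Omega>\<^sub>F\<close> skew on \<open>F\<close>, which
    reduces the kernel in the second argument to the kernel in the first.\<close>
  have skew: "assoc_form L p X Y = - assoc_form L p Y X"
    if X: "X \<in> assoc_dist L p" and Y: "Y \<in> assoc_dist L p" for X Y
  proof -
    obtain \<alpha> \<beta> where XY: "(X, \<alpha>) \<in> L p" "(Y, \<beta>) \<in> L p"
      using X Y by (auto simp: assoc_dist_def)
    show ?thesis
      using assoc_form_eq[where L=L, OF D(3) XY(1) Y] assoc_form_eq[where L=L, OF D(3) XY(2) X]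
        isotropic_pairing[OF D(3) XY] by simp
  qed
  show ?thesis
    unfolding nondegenerate_on_def
  proof (intro conjI ballI impI)
    show "u = 0" if "u \<in> assoc_dist L p" "\<forall>v\<in>assoc_dist L p. assoc_form L p u v = 0" for u
      using zero that by blast
    show "v = 0" if "v \<in> assoc_dist L p" "\<forall>u\<in>assoc_dist L p. assoc_form L p u v = 0" for v
      using zero[OF that(1)] skew[OF that(1)] that(2) by simp
  qed
qed

text \<open>The graph condition puts \<open>(- X, \<alpha>)\<close> in \<open>L\<close>; negating
  the pair gives \<open>(X, - \<alpha>)\<close>, and the two minus signs in the membership criterion
  cancel.\<close>

lemma sharp_eq_uminus_iff:
  assumes A: "smooth_manifold A" and L: "almost_Dirac A L" and G: "is_graph_of A L \<pi>"
    and p: "p \<in> points A" and X: "X \<in> assoc_dist L p" and \<alpha>: "\<alpha> \<in> cotangent_space A p"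
  shows "sharp A \<pi> p \<alpha> = - X \<longleftrightarrow> (\<forall>Y\<in>assoc_dist L p. assoc_form L p X Y = \<alpha> Y)"
proof -
  have \<alpha>': "- \<alpha> \<in> dual_space (tangent_space A p)"
    using subspace_neg[OF subspace_dual_space] \<alpha> unfolding cotangent_space_def by blast
  have "sharp A \<pi> p \<alpha> = - X \<longleftrightarrow> (- X, \<alpha>) \<in> L p"
    unfolding is_graph_ofD[OF G p] using \<alpha> by (simp add: eq_commute)
  also have "\<dots> \<longleftrightarrow> (X, - \<alpha>) \<in> L p"
    using subspace_neg[OF almost_DiracD(2)[OF L p], of "(- X, \<alpha>)"]
      subspace_neg[OF almost_DiracD(2)[OF L p], of "(X, - \<alpha>)"] by auto
  also have "\<dots> \<longleftrightarrow> (\<forall>Y\<in>assoc_dist L p. assoc_form L p X Y = - (- \<alpha>) Y)"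
    using maximal_isotropic_mem_iff[where L=L, OF subspace_tangent_space[OF A]
        almost_DiracD(1)[OF L p] \<alpha>'] X by blast
  finally show ?thesis by simp
qed

theorem corollary3p4:
  fixes A :: "('p::{t2_space, second_countable_topology}, 'e::real_inner) chart set"
    and L :: "('p, 'e) fibres"
  assumes "smooth_manifold A" and "almost_Dirac A L" and "regular A L"
  shows "((\<forall>p\<in>points A. nondegenerate_on (assoc_dist L p) (assoc_form L p)) \<longleftrightarrow>
           (\<exists>\<pi>. bivector_field A \<pi> \<and> is_graph_of A L \<pi>)) \<and>
         (\<forall>\<pi>. bivector_field A \<pi> \<and> is_graph_of A L \<pi> \<longrightarrow>
           (\<forall>X \<alpha>. vector_field_on A (points A) X \<and> (\<forall>p\<in>points A. X p \<in> assoc_dist L p) \<and>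
                  one_form_on A (points A) \<alpha> \<longrightarrow>
             ((\<forall>p\<in>points A. sharp A \<pi> p (\<alpha> p) = - X p) \<longleftrightarrow>
              (\<forall>p\<in>points A. \<forall>Y\<in>assoc_dist L p. assoc_form L p (X p) Y = \<alpha> p Y))))"
proof (intro conjI allI impI)
  show "(\<forall>p\<in>points A. nondegenerate_on (assoc_dist L p) (assoc_form L p)) \<longleftrightarrow>
      (\<exists>\<pi>. bivector_field A \<pi> \<and> is_graph_of A L \<pi>)"
    using bivector_field_Dirac_vec[OF assms(1,2)] is_graph_of_Dirac_vec[OF assms(1,2)]
      graph_nondegenerate[OF assms(1,2)] by blast
next
  fix \<pi> X \<alpha>
  assume \<pi>: "bivector_field A \<pi> \<and> is_graph_of A L \<pi>"
    and "vector_field_on A (points A) X \<and> (\<forall>p\<in>points A. X p \<in> assoc_dist L p) \<and>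
      one_form_on A (points A) \<alpha>"
  \<comment> \<open>The equivalence for sections already holds at each point separately.\<close>
  then have "sharp A \<pi> p (\<alpha> p) = - X p \<longleftrightarrow> (\<forall>Y\<in>assoc_dist L p. assoc_form L p (X p) Y = \<alpha> p Y)"
    if "p \<in> points A" for p
    using sharp_eq_uminus_iff[OF assms(1,2)] that unfolding one_form_on_def by blast
  then show "(\<forall>p\<in>points A. sharp A \<pi> p (\<alpha> p) = - X p) \<longleftrightarrow>
      (\<forall>p\<in>points A. \<forall>Y\<in>assoc_dist L p. assoc_form L p (X p) Y = \<alpha> p Y)"
    by blast
qed

end
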